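(* Let $d,K,n$ be positive integers with $K\ge2$ and $d\ge K$, let $N=nK$, let $\lambda_W,\lambda_H,\lambda_b>0$ and $\delta\in[0,1)$ with $\sqrt{KN\lambda_W\lambda_H}+\delta<1$. Let $a^\delta=\log\!\left(\frac{K}{\sqrt{KN\lambda_W\lambda_H}+\delta}-K+1\right)$ and $$p_t=\frac{e^{a^\delta}}{K-1+e^{a^\delta}}.$$ Let $(W,H,b)$ be a global minimizer of the regularized loss $\mathcal{L}$, i.e. for some $P\in\mathbb{R}^{d\times K}$ with $P^\top P=I_K$, $$W=\left(\tfrac{n\lambda_H}{\lambda_W}\right)^{1/4}\sqrt{a^\delta}\,P\left(I_K-\tfrac1K\mathbf{1}_K\mathbf{1}_K^\top\right),\quad H=\left(\tfrac{\lambda_W}{n\lambda_H}\right)^{1/4}\sqrt{a^\delta}\,P\left(I_K-\tfrac1K\mathbf{1}_K\mathbf{1}_K^\top\right)Y,\quad b=0 .$$ Let $\phi(W,H)=\frac1N\,l_{CE}(W^\top H,Y^\delta)$ be the empirical loss. Then, at this point, the Hessian $\nabla^2_W\phi$ of $\phi$ with respect to $W$ (with $H$ fixed) and the Hessian $\nabla^2_H\phi$ of $\phi$ with respect to $H$ (with $W$ fixed) have condition numbers $$\kappa(\nabla^2_W\phi)=\kappa(\nabla^2_H\phi)=K\,p_t .$$ Consequently, with $K,n,\lambda_W,\lambda_H$ fixed, a larger $\delta$ (within the range $\sqrt{KN\lambda_W\lambda_H}+\delta<1$) gives a smaller $p_t$ and hence a smaller condition number.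
   Context: $\mathbf{1}_m\in\mathbb{R}^m$ is the all-ones vector, $e_k$ the $k$-th standard basis vector of $\mathbb{R}^K$. The dataset is balanced: $K$ classes with $n$ samples each; $Y=[e_1\mathbf{1}_n^\top,\dots,e_K\mathbf{1}_n^\top]\in\mathbb{R}^{K\times N}$ and $Y^\delta=(1-\delta)Y+\frac{\delta}{K}\mathbf{1}_K\mathbf{1}_N^\top$. For $z,y\in\mathbb{R}^K$, $l_{CE}(z,y)=-\sum_j y_j\log p_j$ with $p=\mathrm{Softmax}(z)$; for $K\times N$ matrices $l_{CE}$ is the sum of the column-wise values. The regularized loss is $$\mathcal{L}(W,H,b)=\tfrac1N l_{CE}(W^\top H+b\mathbf{1}_N^\top,Y^\delta)+\tfrac{\lambda_W}{2}\|W\|_F^2+\tfrac{\lambda_H}{2}\|H\|_F^2+\tfrac{\lambda_b}{2}\|b\|^2,$$ for $W\in\mathbb{R}^{d\times K}$, $H\in\mathbb{R}^{d\times N}$, $b\in\mathbb{R}^K$. Hessians are taken with respect to $\mathrm{vec}(W)\in\mathbb{R}^{dK}$ and $\mathrm{vec}(H)\in\mathbb{R}^{dN}$ respectively. Both are singular positive semidefinite matrices; the condition number $\kappa$ of such a matrix is the ratio of its largest eigenvalue to its smallest nonzero eigenvalue. The number $p_t$ is the softmax probability the minimizer assigns to the correct class.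
   Formalization: For K=2 all nonzero eigenvalues of each Hessian coincide, so the condition number is 1, not K p_t > 1; the formula K p_t and the strict decrease of the condition number in δ are stated for K≥3, with value 1 for K=2, while the decrease of p_t is kept for all K≥2. *)

theory Defs
  imports "HOL-Analysis.Analysis"
begin

text \<open>
  Conventions. The class index set is a finite type \<open>'k\<close> (so \<open>K = CARD('k)\<close>), the index set of
  the samples of one class is \<open>'n\<close>, and the feature coordinates are indexed by \<open>'d\<close>.
  A sample is a pair (class, number within the class), so the \<open>N = nK\<close> samples
  are indexed by \<open>'k \<times> 'n\<close> and balancedness is built into the index type.
  A real \<open>r \<times> c\<close> matrix has type \<open>real^'c^'r\<close>.
\<close>

section \<open>Eigenvalues, condition number, Hessian\<close>

definition eigenvalue_of :: "real^'m^'m \<Rightarrow> real \<Rightarrow> bool" where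
  "eigenvalue_of A \<mu> \<longleftrightarrow> (\<exists>v. v \<noteq> 0 \<and> A *v v = \<mu> *\<^sub>R v)"

text \<open>Meant for nonzero positive semidefinite symmetric matrices, which may be singular.\<close>

definition condition_number :: "real^'m^'m \<Rightarrow> real" where
  "condition_number A =
     Max {\<mu>. eigenvalue_of A \<mu>} / Min {\<mu>. eigenvalue_of A \<mu> \<and> \<mu> \<noteq> 0}"

text \<open>Matrix of second partial derivatives \<open>\<partial>\<^sub>i \<partial>\<^sub>j f\<close>; meaningful at points near
  which \<open>f\<close> is twice differentiable.\<close>

definition hessian :: "(real^'m \<Rightarrow> real) \<Rightarrow> real^'m \<Rightarrow> real^'m^'m" where
  "hessian f x =
     (\<chi> i j. frechet_derivative (\<lambda>y. frechet_derivative f (at y) (axis j 1)) (at x) (axis i 1))"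

text \<open>\<open>vec(A)\<close> for an \<open>r \<times> c\<close> matrix, with entries indexed by (column, row) instead of by a
  position in \<open>1..rc\<close>, and its inverse.\<close>

definition vectorize :: "real^'c^'r \<Rightarrow> real^('c::finite \<times> 'r::finite)" where
  "vectorize A = (\<chi> p. A $ snd p $ fst p)"

definition unvectorize :: "real^('c::finite \<times> 'r::finite) \<Rightarrow> real^'c^'r" where
  "unvectorize v = (\<chi> r c. v $ (c, r))"

section \<open>Cross-entropy loss with label smoothing\<close>

definition softmax :: "real^'k \<Rightarrow> real^'k" where
  "softmax z = (\<chi> j. exp (z $ j) / (\<Sum>i\<in>UNIV. exp (z $ i)))"

definition ce_loss :: "real^'k \<Rightarrow> real^'k \<Rightarrow> real" where
  "ce_loss z y = - (\<Sum>j\<in>UNIV. y $ j * ln (softmax z $ j))"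

definition ce_loss_mat :: "real^'s^'k \<Rightarrow> real^'s^'k \<Rightarrow> real" where
  "ce_loss_mat Z Y = (\<Sum>s\<in>UNIV. ce_loss (column s Z) (column s Y))"

definition label_mat :: "real^('k::finite \<times> 'n::finite)^'k" where
  "label_mat = (\<chi> j s. if fst s = j then 1 else 0)"

definition smoothed_label_mat :: "real \<Rightarrow> real^('k::finite \<times> 'n::finite)^'k" where
  "smoothed_label_mat \<delta> =
     (1 - \<delta>) *\<^sub>R label_mat + (\<delta> / real CARD('k)) *\<^sub>R (\<chi> j s. 1)"

definition empirical_loss :: "real \<Rightarrow> real^'k^'d \<Rightarrow> real^('k::finite \<times> 'n::finite)^'d \<Rightarrow> real" where
  "empirical_loss \<delta> W H =
     ce_loss_mat (transpose W ** H) (smoothed_label_mat \<delta>) / real CARD('k \<times> 'n)"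

text \<open>The norm of the type \<open>real^'c^'r\<close> is the Frobenius norm.\<close>

definition regularized_loss ::
  "real \<Rightarrow> real \<Rightarrow> real \<Rightarrow> real \<Rightarrow> real^'k^'d \<Rightarrow> real^('k::finite \<times> 'n::finite)^'d \<Rightarrow> real^'k \<Rightarrow> real" where
  "regularized_loss lW lH lb \<delta> W H b =
     ce_loss_mat (transpose W ** H + (\<chi> j s. b $ j)) (smoothed_label_mat \<delta>) / real CARD('k \<times> 'n)
     + lW / 2 * (norm W)\<^sup>2 + lH / 2 * (norm H)\<^sup>2 + lb / 2 * (norm b)\<^sup>2"

definition global_minimizer ::
  "real \<Rightarrow> real \<Rightarrow> real \<Rightarrow> real \<Rightarrow> real^'k^'d \<Rightarrow> real^('k::finite \<times> 'n::finite)^'d \<Rightarrow> real^'k \<Rightarrow> bool" where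
  "global_minimizer lW lH lb \<delta> W H b \<longleftrightarrow>
     (\<forall>(W' :: real^'k^'d) (H' :: real^('k \<times> 'n)^'d) (b' :: real^'k).
       regularized_loss lW lH lb \<delta> W H b \<le> regularized_loss lW lH lb \<delta> W' H' b')"

definition hessian_W ::
  "real \<Rightarrow> real^'k^'d \<Rightarrow> real^('k::finite \<times> 'n::finite)^'d \<Rightarrow> real^('k::finite \<times> 'd::finite)^('k::finite \<times> 'd::finite)" where
  "hessian_W \<delta> W H = hessian (\<lambda>w. empirical_loss \<delta> (unvectorize w) H) (vectorize W)"

definition hessian_H ::
  "real \<Rightarrow> real^'k^'d \<Rightarrow> real^('k::finite \<times> 'n::finite)^'d \<Rightarrow> real^(('k::finite \<times> 'n::finite) \<times> 'd)^(('k::finite \<times> 'n::finite) \<times> 'd)" where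
  "hessian_H \<delta> W H = hessian (\<lambda>h. empirical_loss \<delta> W (unvectorize h)) (vectorize H)"

section \<open>Explicit form of the minimizers\<close>

definition a_param :: "nat \<Rightarrow> nat \<Rightarrow> real \<Rightarrow> real \<Rightarrow> real \<Rightarrow> real" where
  "a_param K N lW lH \<delta> =
     ln (real K / (sqrt (real K * real N * lW * lH) + \<delta>) - real K + 1)"

definition p_target :: "nat \<Rightarrow> nat \<Rightarrow> real \<Rightarrow> real \<Rightarrow> real \<Rightarrow> real" where
  "p_target K N lW lH \<delta> =
     exp (a_param K N lW lH \<delta>) / (real K - 1 + exp (a_param K N lW lH \<delta>))"

definition centering_mat :: "real^'k^'k" where
  "centering_mat = mat 1 - (1 / real CARD('k)) *\<^sub>R (\<chi> i j. 1)"

definition collapsed_point ::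
  "real \<Rightarrow> real \<Rightarrow> real \<Rightarrow> real^'k^'d \<Rightarrow> real^'k^'d \<Rightarrow> real^('k::finite \<times> 'n::finite)^'d \<Rightarrow> real^'k \<Rightarrow> bool" where
  "collapsed_point lW lH \<delta> P W H b \<longleftrightarrow>
     (let n = real CARD('n); a = a_param CARD('k) CARD('k \<times> 'n) lW lH \<delta> in
       W = ((n * lH / lW) powr (1/4) * sqrt a) *\<^sub>R (P ** centering_mat) \<and>
       H = ((lW / (n * lH)) powr (1/4) * sqrt a) *\<^sub>R (P ** centering_mat ** label_mat) \<and>
       b = 0)"

end

theory Submission
  imports Defs
begin

text \<open>
  Let \<open>w\<^sub>k\<close> and \<open>h\<^sub>s\<close> be the columns of \<open>W\<close> and \<open>H\<close>. Expanding the cross-entropy to first order at the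
  collapsed logits and completing squares writes the regularized loss as a constant plus Bregman
  remainders of log-sum-exp plus squared norms, all nonnegative. They vanish together exactly when
  the logits are the collapsed ones up to a shift, the \<open>w\<^sub>k\<close> sum to zero, \<open>b = 0\<close>, and every \<open>h\<^sub>s\<close> is a
  fixed multiple of the \<open>w\<^sub>k\<close> of its class; the Gram matrix of the \<open>w\<^sub>k\<close> is then a multiple of the
  centring matrix, and a unit vector orthogonal to them completes them to an orthonormal family.

  At such a point every softmax vector is \<open>q\<close> off the target class and \<open>q + g\<close> on it, with
  \<open>K q + g = 1\<close>. Up to a partial isometry and a scalar, either Hessian is the identity plus \<open>K g\<close>
  times the sampling of the target entries, so its nonzero eigenvalues lie between \<open>1\<close> and
  \<open>1 + (K - 1) g = K p\<^sub>t\<close>; both bounds are attained if \<open>K \<ge> 3\<close>, and only the upper one if \<open>K = 2\<close>.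
\<close>

section \<open>Softmax and cross-entropy\<close>

lemma sum_exp_pos: "0 < (\<Sum>i\<in>UNIV. exp ((z::real^'k) $ i))"
  by (intro sum_pos) auto

lemma softmax_pos: "0 < softmax z $ j"
  by (simp add: softmax_def sum_exp_pos)

lemma sum_softmax: "(\<Sum>j\<in>UNIV. softmax z $ j) = 1"
  using sum_exp_pos[of z] by (simp add: softmax_def flip: sum_divide_distrib)

definition log_sum_exp :: "real^'k \<Rightarrow> real" where
  "log_sum_exp z = ln (\<Sum>i\<in>UNIV. exp (z $ i))"

lemma ln_softmax: "ln (softmax z $ j) = z $ j - log_sum_exp z"
  using sum_exp_pos[of z] by (simp add: softmax_def log_sum_exp_def ln_div)

lemma softmax_eq_exp: "softmax z $ j = exp (z $ j - log_sum_exp z)"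
  using softmax_pos[of z j] by (simp flip: ln_softmax)

lemma ce_loss_eq:
  assumes "(\<Sum>j\<in>UNIV. y $ j) = 1"
  shows "ce_loss z y = log_sum_exp z - y \<bullet> z"
  using assms by (simp add: ce_loss_def ln_softmax inner_vec_def right_diff_distrib sum_subtractf
      flip: sum_distrib_right)

text \<open>The Bregman divergence of \<open>log_sum_exp\<close>, whose gradient is
  \<open>softmax\<close>; it equals the Kullback-Leibler divergence of \<open>softmax z'\<close>
  from \<open>softmax z\<close>.\<close>

definition bregman :: "real^'k \<Rightarrow> real^'k \<Rightarrow> real" where
  "bregman z' z = log_sum_exp z' - log_sum_exp z - softmax z \<bullet> (z' - z)"

text \<open>Weighting by \<open>softmax z\<close> turns the exponential into
  \<open>softmax z'\<close>, and both softmax vectors have total mass 1, so the exponential and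
  constant parts cancel. Every remaining summand is nonnegative, which gives the sign and the
  equality case term by term.\<close>

lemma bregman_gap:
  fixes z z' :: "real^'k"
  defines "S \<equiv> log_sum_exp z' - log_sum_exp z"
  shows "bregman z' z = (\<Sum>j\<in>UNIV. softmax z $ j * (exp (z' $ j - z $ j - S) - 1 - (z' $ j - z $ j - S)))"
proof -
  have e: "softmax z $ j * exp (z' $ j - z $ j - S) = softmax z' $ j" for j
    by (simp add: softmax_eq_exp S_def flip: exp_add)
  show ?thesis
    by (simp add: right_diff_distrib sum_subtractf e sum_softmax bregman_def inner_vec_def
        flip: sum_distrib_right) (simp add: S_def)
qed

lemma exp_minus_one_minus_eq_0D:
  assumes "exp x - 1 - x = (0::real)"
  shows "x = 0"
  using ln_eq_minus_one[OF exp_gt_zero, of x] assms by (simp add: algebra_simps)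

lemma exp_minus_one_minus_nonneg: "0 \<le> exp x - 1 - (x::real)"
  using exp_ge_add_one_self[of x] by linarith

lemma bregman_nonneg: "0 \<le> bregman z' z"
  unfolding bregman_gap
  by (intro sum_nonneg mult_nonneg_nonneg exp_minus_one_minus_nonneg less_imp_le[OF softmax_pos])

lemma bregman_eq_0_iff: "bregman z' z = 0 \<longleftrightarrow> (\<exists>t. \<forall>j. z' $ j = z $ j + t)"
proof
  define S where "S = log_sum_exp z' - log_sum_exp z"
  assume "bregman z' z = 0"
  hence "\<forall>j\<in>UNIV. softmax z $ j * (exp (z' $ j - z $ j - S) - 1 - (z' $ j - z $ j - S)) = 0"
    unfolding bregman_gap S_def
    by (subst (asm) sum_nonneg_eq_0_iff)
      (auto intro!: mult_nonneg_nonneg exp_minus_one_minus_nonneg less_imp_le[OF softmax_pos])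
  hence "z' $ j - z $ j - S = 0" for j
    using softmax_pos[of z j] exp_minus_one_minus_eq_0D[of "z' $ j - z $ j - S"]
    by (auto dest!: spec[of _ j])
  thus "\<exists>t. \<forall>j. z' $ j = z $ j + t" by (intro exI[of _ S]) (auto simp: algebra_simps)
next
  assume "\<exists>t. \<forall>j. z' $ j = z $ j + t"
  then obtain t where t: "\<And>j. z' $ j = z $ j + t" by auto
  have "log_sum_exp z' = log_sum_exp z + t"
    using sum_exp_pos[of z] by (simp add: log_sum_exp_def t exp_add ln_mult flip: sum_distrib_right)
  moreover have "softmax z \<bullet> (z' - z) = t"
    by (simp add: inner_vec_def t sum_softmax flip: sum_distrib_right)
  ultimately show "bregman z' z = 0" by (simp add: bregman_def)
qed

text \<open>The covariance of \<open>x\<close> and \<open>y\<close> under the weights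
  \<open>p\<close>, that is, the bilinear form of diag(p) - p p^T. For \<open>p = softmax z\<close>
  it is the Hessian form of \<open>log_sum_exp\<close> at \<open>z\<close>.\<close>

definition softmax_form :: "real^'k \<Rightarrow> real^'k \<Rightarrow> real^'k \<Rightarrow> real" where
  "softmax_form p x y = (\<Sum>j\<in>UNIV. p $ j * x $ j * y $ j) - (p \<bullet> x) * (p \<bullet> y)"

lemma has_derivative_log_sum_exp:
  "(log_sum_exp has_derivative (\<lambda>h. softmax z \<bullet> h)) (at z)"
proof -
  have "((\<lambda>z. ln (\<Sum>i\<in>UNIV. exp (z $ i))) has_derivative
     (\<lambda>h. (\<Sum>i\<in>UNIV. exp (z $ i) * h $ i) * inverse (\<Sum>i\<in>UNIV. exp (z $ i)))) (at z)"
    using sum_exp_pos[of z]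
    by (auto intro!: derivative_eq_intros bounded_linear_imp_has_derivative[OF bounded_linear_vec_nth]
        simp: mult.commute)
  thus ?thesis
    by (simp add: log_sum_exp_def[abs_def] softmax_def inner_vec_def divide_inverse
        sum_distrib_left mult_ac)
qed

lemma has_derivative_softmax:
  "((\<lambda>z. softmax z \<bullet> w) has_derivative (\<lambda>h. softmax_form (softmax z) h w)) (at z)"
proof -
  have "((\<lambda>z. softmax z \<bullet> w) has_derivative
     (\<lambda>h. \<Sum>j\<in>UNIV. (softmax z $ j * (h $ j - softmax z \<bullet> h)) * w $ j)) (at z)"
    \<comment> \<open>Softmax is written as the exponential of \<open>z $ j - log_sum_exp z\<close>,
      so its derivative follows from that of \<open>log_sum_exp\<close> without a quotient
      rule.\<close>
    unfolding inner_vec_def[of "softmax _" w] inner_real_def softmax_eq_exp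
    by (auto intro!: derivative_eq_intros has_derivative_log_sum_exp bounded_linear_imp_has_derivative[OF bounded_linear_vec_nth] simp: mult_ac)
  moreover have "(\<Sum>j\<in>UNIV. (softmax z $ j * (h $ j - softmax z \<bullet> h)) * w $ j)
     = softmax_form (softmax z) h w" for h
    by (simp add: softmax_form_def right_diff_distrib left_diff_distrib sum_subtractf sum_distrib_left
        inner_vec_def[of _ w] mult_ac)
  ultimately show ?thesis by (simp only:)
qed

lemma softmax_form_linear:
  "linear (softmax_form p x)" "linear (\<lambda>x. softmax_form p x y)"
  by (rule linearI; simp add: softmax_form_def algebra_simps inner_add_right sum.distrib sum_distrib_left)+

text \<open>Passes from the entrywise definition of \<open>hessian\<close> to its bilinear form, the
  shape in which the eigenvalues are studied.\<close>

lemma bilinear_eq_matrix: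
  fixes F :: "real^'m \<Rightarrow> real^'m \<Rightarrow> real"
  assumes "\<And>v. linear (\<lambda>u. F u v)" and "\<And>u. linear (F u)"
  shows "u \<bullet> ((\<chi> i j. F (axis i 1) (axis j 1)) *v v) = F u v"
proof -
  have "F u v = F (\<Sum>i\<in>UNIV. u $ i *\<^sub>R axis i 1) (\<Sum>j\<in>UNIV. v $ j *\<^sub>R axis j 1)"
    by (simp flip: scalar_mult_eq_scaleR add: basis_expansion)
  also have "\<dots> = (\<Sum>j\<in>UNIV. \<Sum>i\<in>UNIV. v $ j * (u $ i * F (axis i 1) (axis j 1)))"
    by (simp add: linear_sum[OF assms(1)] linear_sum[OF assms(2)] linear_scale[OF assms(1)]
        linear_scale[OF assms(2)] sum_distrib_left)
  also have "\<dots> = (\<Sum>i\<in>UNIV. \<Sum>j\<in>UNIV. v $ j * (u $ i * F (axis i 1) (axis j 1)))"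
    by (rule sum.swap)
  finally show ?thesis
    by (simp add: inner_vec_def matrix_vector_mult_def sum_distrib_left mult_ac)
qed


text \<open>For labels of total mass 1 the cross-entropy is \<open>log_sum_exp\<close> minus a term
  linear in the logits, so the labels disappear from the second derivative. The logits are linear in
  the variable, so the chain rule adds no second-order term of their own.\<close>

lemma hessian_ce:
  fixes B :: "'s::finite \<Rightarrow> real^'m \<Rightarrow> real^'k"
  assumes B: "\<And>s. linear (B s)" and y: "\<And>s. (\<Sum>j\<in>UNIV. y s $ j) = 1"
  shows "u \<bullet> (hessian (\<lambda>v. (\<Sum>s\<in>UNIV. ce_loss (B s v) (y s)) / N) x *v v)
    = (\<Sum>s\<in>UNIV. softmax_form (softmax (B s x)) (B s u) (B s v)) / N"
proof -
  let ?F = "\<lambda>u v. (\<Sum>s\<in>UNIV. softmax_form (softmax (B s x)) (B s u) (B s v)) / N"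
  note D = bounded_linear.has_derivative[OF linear_conv_bounded_linear[THEN iffD1, OF B] has_derivative_ident]
  have d1: "frechet_derivative (\<lambda>v. (\<Sum>s\<in>UNIV. ce_loss (B s v) (y s)) / N) (at v)
      = (\<lambda>h. (\<Sum>s\<in>UNIV. (softmax (B s v) - y s) \<bullet> B s h) / N)" for v
  proof (rule frechet_derivative_at[symmetric])
    show "((\<lambda>v. (\<Sum>s\<in>UNIV. ce_loss (B s v) (y s)) / N) has_derivative
       (\<lambda>h. (\<Sum>s\<in>UNIV. (softmax (B s v) - y s) \<bullet> B s h) / N)) (at v)"
      unfolding ce_loss_eq[OF y] divide_inverse
      by (auto intro!: derivative_eq_intros D has_derivative_compose[OF D has_derivative_log_sum_exp]
           simp: inner_diff_left)
  qed
  have d2: "frechet_derivative (\<lambda>v. (\<Sum>s\<in>UNIV. (softmax (B s v) - y s) \<bullet> B s h) / N) (at x) = (\<lambda>u. ?F u h)" for h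
  proof (rule frechet_derivative_at[symmetric])
    show "((\<lambda>v. (\<Sum>s\<in>UNIV. (softmax (B s v) - y s) \<bullet> B s h) / N) has_derivative (\<lambda>u. ?F u h)) (at x)"
      unfolding inner_diff_left divide_inverse
      by (intro has_derivative_mult_left has_derivative_sum
          has_derivative_eq_rhs[OF has_derivative_diff[OF has_derivative_compose[OF D has_derivative_softmax]
            has_derivative_const]]) simp
  qed
  have "linear (\<lambda>u. ?F u v)" for v
    by (rule linearI)
      (simp_all add: linear_add[OF B] linear_scale[OF B] linear_add[OF softmax_form_linear(2)]
        linear_scale[OF softmax_form_linear(2)] sum.distrib add_divide_distrib flip: sum_distrib_left)
  moreover have "linear (\<lambda>v. ?F u v)" for u
    by (rule linearI)
      (simp_all add: linear_add[OF B] linear_scale[OF B] linear_add[OF softmax_form_linear(1)]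
        linear_scale[OF softmax_form_linear(1)] sum.distrib add_divide_distrib flip: sum_distrib_left)
  ultimately show ?thesis
    unfolding hessian_def d1 d2 by (rule bilinear_eq_matrix)
qed

section \<open>Condition numbers\<close>

text \<open>Eigenvectors chosen for distinct eigenvalues are orthogonal, hence independent.
  Finiteness makes the \<open>Max\<close> and \<open>Min\<close> in \<open>condition_number\<close>
  meaningful.\<close>

lemma finite_eigenvalues:
  fixes A :: "real^'m^'m"
  assumes sym: "\<And>u v. u \<bullet> (A *v v) = (A *v u) \<bullet> v"
  shows "finite {\<mu>. eigenvalue_of A \<mu>}"
proof -
  let ?S = "{\<mu>. eigenvalue_of A \<mu>}"
  have "\<forall>\<mu>\<in>?S. \<exists>v. v \<noteq> 0 \<and> A *v v = \<mu> *\<^sub>R v" by (auto simp: eigenvalue_of_def)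
  then obtain v where v: "\<And>\<mu>. \<mu> \<in> ?S \<Longrightarrow> v \<mu> \<noteq> 0 \<and> A *v v \<mu> = \<mu> *\<^sub>R v \<mu>" by metis
  have orth: "v \<mu> \<bullet> v \<nu> = 0" if "\<mu> \<in> ?S" "\<nu> \<in> ?S" "\<mu> \<noteq> \<nu>" for \<mu> \<nu>
    using sym[of "v \<mu>" "v \<nu>"] v[OF that(1)] v[OF that(2)] that(3) by auto
  have inj: "inj_on v ?S"
    using orth v by (metis inj_onI inner_eq_zero_iff)
  have "pairwise orthogonal (v ` ?S)"
    using orth by (auto simp: pairwise_def orthogonal_def)
  moreover have "0 \<notin> v ` ?S" using v by fastforce
  ultimately have "finite (v ` ?S)"
    by (intro independent_imp_finite pairwise_orthogonal_independent)
  thus ?thesis using inj by (rule finite_imageD)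
qed

lemma condition_numberI:
  fixes A :: "real^'m^'m"
  assumes sym: "\<And>u v. u \<bullet> (A *v v) = (A *v u) \<bullet> v"
    and "eigenvalue_of A M" and "eigenvalue_of A m" and "m \<noteq> 0"
    and "\<And>\<mu>. eigenvalue_of A \<mu> \<Longrightarrow> \<mu> \<le> M"
    and "\<And>\<mu>. eigenvalue_of A \<mu> \<Longrightarrow> \<mu> \<noteq> 0 \<Longrightarrow> m \<le> \<mu>"
  shows "condition_number A = M / m"
proof -
  have "Max {\<mu>. eigenvalue_of A \<mu>} = M"
    using assms finite_eigenvalues[OF sym] by (intro Max_eqI) auto
  moreover have "Min {\<mu>. eigenvalue_of A \<mu> \<and> \<mu> \<noteq> 0} = m"
    using assms by (intro Min_eqI finite_subset[OF _ finite_eigenvalues[OF sym]]) auto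
  ultimately show ?thesis by (simp add: condition_number_def)
qed

lemma centered_component_le:
  fixes x :: "real^'k"
  assumes "(\<Sum>j\<in>UNIV. x $ j) = 0"
  shows "real CARD('k) * (x $ c)\<^sup>2 \<le> (real CARD('k) - 1) * (x \<bullet> x)"
proof -
  define K where "K = real CARD('k)"
  have K: "K > 0" by (simp add: K_def)
  \<comment> \<open>The projection of the unit vector at \<open>c\<close> to the sum-zero subspace.
    It has the same inner product with \<open>x\<close>, but squared norm 1 - 1/K, which makes
    Cauchy-Schwarz sharp.\<close>
  define e where "e = axis c 1 - (1 / K) *\<^sub>R (\<chi> j. 1 :: real^'k)"
  have 1: "x \<bullet> e = x $ c"
    using assms by (simp add: e_def inner_diff_right inner_axis) (simp add: inner_vec_def)
  have "e \<bullet> e = 1 - 1 / K"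
    using K by (simp add: e_def inner_diff_right inner_diff_left inner_axis inner_axis')
      (simp add: inner_vec_def K_def field_simps)
  with Cauchy_Schwarz_ineq[of x e] 1 have "(x $ c)\<^sup>2 \<le> (x \<bullet> x) * (1 - 1 / K)" by simp
  hence "K * (x $ c)\<^sup>2 \<le> K * ((x \<bullet> x) * (1 - 1 / K))"
    using K by simp
  also have "\<dots> = (K - 1) * (x \<bullet> x)"
    using K by (simp add: field_simps)
  finally show ?thesis by (simp add: K_def)
qed

text \<open>With two coordinates the entries are opposite, so the bound of
  \<open>centered_component_le\<close> is always an equality. This collapses the nonzero spectrum to
  one point when K = 2.\<close>

lemma centered_component_eq:
  fixes x :: "real^'k"
  assumes "(\<Sum>j\<in>UNIV. x $ j) = 0" and "CARD('k) = 2"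
  shows "2 * (x $ c)\<^sup>2 = x \<bullet> x"
proof -
  from assms(2) obtain d where d: "UNIV = {c, d}" "c \<noteq> d"
    unfolding card_2_iff by (metis UNIV_I insertE insert_commute singletonD)
  have "x $ c + x $ d = 0"
    using assms(1) d(2) unfolding d(1) by simp
  hence "x $ d = - x $ c" by simp
  thus ?thesis
    using d(2) unfolding inner_vec_def d(1) by (simp add: power2_eq_square)
qed

text \<open>Through the partial isometry \<open>X\<close> onto the arrays satisfying \<open>R\<close>, \<open>H\<close> becomes
  \<open>\<kappa>\<close> times the sum of the identity and \<open>K g\<close> times the sampling of the entries \<open>(s, f s)\<close>. The array of
  centred unit vectors is an eigenvector for the largest eigenvalue, and an array vanishing at the
  sampled entries one for \<open>\<kappa>\<close>; the latter exists only if \<open>K \<ge> 3\<close>.\<close>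

lemma condition_number_partial_isometry:
  fixes H :: "real^'m^'m" and X :: "'s::finite \<Rightarrow> real^'m \<Rightarrow> real^'k" and f :: "'s \<Rightarrow> 'k"
  defines "K \<equiv> real CARD('k)"
  assumes form: "\<And>u v. u \<bullet> (H *v v)
      = \<kappa> * (\<Sum>s\<in>UNIV. X s u \<bullet> X s v + K * g * (X s u $ f s * X s v $ f s))"
    and pos: "\<kappa> > 0" "g > 0" and card: "CARD('k) \<ge> 2"
    and lin: "\<And>s. linear (X s)"
    and range: "\<And>v. R (\<lambda>s. X s v)"
    and centered: "\<And>U s. R U \<Longrightarrow> (\<Sum>k\<in>UNIV. U s $ k) = 0"
    and adjoint: "\<And>U. R U \<Longrightarrow> \<exists>v. (\<forall>s. X s v = U s) \<and> (\<forall>u. u \<bullet> v = (\<Sum>s\<in>UNIV. X s u \<bullet> U s))"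
    and top: "R (\<lambda>s. \<chi> k. (if k = f s then 1 else 0) - 1 / K)"
    and bot: "CARD('k) \<ge> 3 \<Longrightarrow> \<exists>U. R U \<and> (\<exists>s. U s \<noteq> 0) \<and> (\<forall>s. U s $ f s = 0)"
  shows "condition_number H = (if CARD('k) \<ge> 3 then 1 + (K - 1) * g else 1)"
proof -
  have K: "K \<ge> 2" using card by (simp add: K_def)
  have sym: "u \<bullet> (H *v v) = (H *v u) \<bullet> v" for u v
  proof -
    have "u \<bullet> (H *v v) = v \<bullet> (H *v u)"
      unfolding form by (simp add: inner_commute mult.commute)
    thus ?thesis by (simp only: inner_commute)
  qed
  \<comment> \<open>If \<open>v\<close> is the adjoint image of \<open>U\<close> and
    \<open>X\<close> maps it back to \<open>U\<close>, the unweighted part of the form is just the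
    inner product of \<open>u\<close> and \<open>v\<close>; only the sampled entries remain to be
    evaluated.\<close>
  have form_adj: "u \<bullet> (H *v v) = \<kappa> * (u \<bullet> v + K * g * (\<Sum>s\<in>UNIV. X s u $ f s * U s $ f s))"
    if "\<forall>s. X s v = U s" "\<forall>u. u \<bullet> v = (\<Sum>s\<in>UNIV. X s u \<bullet> U s)" for u v U
    using that by (simp add: form sum.distrib sum_distrib_left)
  let ?M = "\<kappa> * (1 + (K - 1) * g)"
  have eig_top: "eigenvalue_of H ?M"
  proof -
    define U :: "'s \<Rightarrow> real^'k" where "U = (\<lambda>s. \<chi> k. (if k = f s then 1 else 0) - 1 / K)"
    from adjoint[OF top] obtain v where v: "\<forall>s. X s v = U s" "\<forall>u. u \<bullet> v = (\<Sum>s\<in>UNIV. X s u \<bullet> U s)"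
      unfolding U_def by auto
    have "X s u \<bullet> U s = X s u $ f s" for s u
      using centered[OF range, of s u]
      by (simp add: inner_vec_def U_def right_diff_distrib sum_subtractf if_distrib[of "(*) _"] sum.delta
          flip: sum_divide_distrib cong: if_cong)
    hence uv: "u \<bullet> v = (\<Sum>s\<in>UNIV. X s u $ f s)" for u using v(2) by simp
    \<comment> \<open>All sampled entries of \<open>U\<close> equal 1 - 1/K, and K g (1 - 1/K) = (K
      - 1) g.\<close>
    have "(\<Sum>s\<in>UNIV. X s u $ f s * U s $ f s) = (u \<bullet> v) * (1 - 1 / K)" for u
      unfolding uv sum_distrib_right by (simp add: U_def)
    hence "u \<bullet> (H *v v) = u \<bullet> (?M *\<^sub>R v)" for u
      using K by (simp add: form_adj[OF v]) (simp add: field_simps)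
    hence "H *v v = ?M *\<^sub>R v" using vector_eq_ldot by blast
    moreover have "v \<noteq> 0"
    proof
      assume "v = 0"
      hence "U s = 0" for s using v(1) by (simp add: linear_0[OF lin] eq_commute[of 0])
      hence "U s $ f s = 0" for s by simp
      thus False using K by (simp add: U_def)
    qed
    ultimately show ?thesis by (auto simp: eigenvalue_of_def)
  qed
  have eig_bot: "eigenvalue_of H \<kappa>" if "CARD('k) \<ge> 3"
  proof -
    from bot[OF that] obtain U where U: "R U" "\<exists>s. U s \<noteq> 0" "\<forall>s. U s $ f s = 0" by blast
    from adjoint[OF U(1)] obtain v where v: "\<forall>s. X s v = U s" "\<forall>u. u \<bullet> v = (\<Sum>s\<in>UNIV. X s u \<bullet> U s)"
      by auto
    have "u \<bullet> (H *v v) = u \<bullet> (\<kappa> *\<^sub>R v)" for u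
      by (simp add: form_adj[OF v] U(3))
    hence "H *v v = \<kappa> *\<^sub>R v" using vector_eq_ldot by blast
    moreover have "v \<noteq> 0" using U(2) v(1) by (auto simp: linear_0[OF lin])
    ultimately show ?thesis by (auto simp: eigenvalue_of_def)
  qed
  have bounds: "\<mu> \<le> ?M \<and> (\<mu> \<noteq> 0 \<longrightarrow> \<kappa> \<le> \<mu>) \<and> (\<mu> \<noteq> 0 \<and> CARD('k) = 2 \<longrightarrow> \<mu> = ?M)"
    if "eigenvalue_of H \<mu>" for \<mu>
  proof -
    from that obtain v where v: "v \<noteq> 0" "H *v v = \<mu> *\<^sub>R v" by (auto simp: eigenvalue_of_def)
    define T where "T = (\<Sum>s\<in>UNIV. X s v \<bullet> X s v)"
    define Q where "Q = (\<Sum>s\<in>UNIV. K * (X s v $ f s)\<^sup>2)"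
    have \<mu>: "\<mu> * (v \<bullet> v) = \<kappa> * (T + g * Q)"
      using form[of v v] v(2) by (simp add: T_def Q_def sum.distrib sum_distrib_left power2_eq_square mult_ac)
    \<comment> \<open>\<open>w\<close> is the orthogonal projection of \<open>v\<close> to the
      complement of the common kernel of the maps \<open>X s\<close>, and \<open>T\<close> is its
      squared norm.\<close>
    from adjoint[OF range[of v]] obtain w where w: "\<And>s. X s w = X s v"
      "\<And>u. u \<bullet> w = (\<Sum>s\<in>UNIV. X s u \<bullet> X s v)" by auto
    have X0: "X s (v - w) = 0" for s by (simp add: linear_diff[OF lin] w(1))
    have vw: "(v - w) \<bullet> v = v \<bullet> v - T"
      using w(2)[of v] by (simp add: T_def inner_diff_left inner_commute[of w v])
    have "(v - w) \<bullet> w = 0" by (simp add: w(2) X0)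
    hence "(v - w) \<bullet> (v - w) = v \<bullet> v - T" using vw by (simp add: inner_diff_right)
    hence T_le: "T \<le> v \<bullet> v" using inner_ge_zero[of "v - w"] by linarith
    \<comment> \<open>The image of \<open>H\<close> is orthogonal to that kernel. An eigenvector
      with nonzero eigenvalue lies in the image, so its kernel part \<open>v - w\<close>
      vanishes.\<close>
    have "(v - w) \<bullet> (H *v v) = 0" by (simp add: form X0)
    hence T_eq: "T = v \<bullet> v" if "\<mu> \<noteq> 0" using vw v(2) that by simp
    have T0: "0 \<le> T" by (simp add: T_def sum_nonneg)
    have Q_le: "Q \<le> (K - 1) * T"
      unfolding Q_def T_def sum_distrib_left K_def
      by (intro sum_mono centered_component_le centered[OF range])
    have Q0: "0 \<le> Q" using K by (simp add: Q_def sum_nonneg)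
    have vv: "v \<bullet> v > 0" using v(1) by simp
    have "g * Q \<le> g * ((K - 1) * T)" using Q_le pos by simp
    hence "T + g * Q \<le> (1 + (K - 1) * g) * T" by (simp add: algebra_simps)
    also have "\<dots> \<le> (1 + (K - 1) * g) * (v \<bullet> v)"
      using T_le K pos by (intro mult_left_mono) auto
    finally have "\<mu> * (v \<bullet> v) \<le> ?M * (v \<bullet> v)"
      unfolding \<mu> using pos by (simp add: mult.assoc)
    hence 1: "\<mu> \<le> ?M" using vv by simp
    have 2: "\<kappa> \<le> \<mu>" if "\<mu> \<noteq> 0"
    proof -
      have "\<kappa> * (v \<bullet> v) \<le> \<mu> * (v \<bullet> v)"
        unfolding \<mu> using T_eq[OF that] Q0 pos by simp
      thus ?thesis using vv by simp
    qed
    have 3: "\<mu> = ?M" if "\<mu> \<noteq> 0" "CARD('k) = 2"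
    proof -
      have "Q = T"
        unfolding Q_def T_def K_def using that(2) centered_component_eq[OF centered[OF range] that(2)]
        by (intro sum.cong) auto
      hence "\<mu> * (v \<bullet> v) = ?M * (v \<bullet> v)"
        using \<mu> T_eq[OF that(1)] that(2) by (simp add: K_def algebra_simps)
      thus ?thesis using vv by simp
    qed
    from 1 2 3 show ?thesis by blast
  qed
  have M: "?M > 0" using pos K by (intro mult_pos_pos add_pos_nonneg) auto
  show ?thesis
  proof (cases "CARD('k) \<ge> 3")
    case True
    have "condition_number H = ?M / \<kappa>"
      using bounds pos by (intro condition_numberI sym eig_top eig_bot True) auto
    thus ?thesis using True pos by simp
  next
    case False
    \<comment> \<open>Here every nonzero eigenvalue is \<open>?M\<close>, which is therefore both
      the largest and the smallest one.\<close>
    hence "CARD('k) = 2" using card by simp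
    hence "condition_number H = ?M / ?M"
      using bounds M by (intro condition_numberI sym eig_top) auto
    moreover have "?M / ?M = 1" using M by (intro divide_self) linarith
    ultimately show ?thesis using False by simp
  qed
qed

section \<open>Hessians at collapsed points\<close>

text \<open>A covariance ignores constant shifts, as \<open>p\<close> has total mass 1. For the
  centred parts the means are g times the target entries, leaving the coefficient g - g^2 = g (1 -
  g) = q K g at the target.\<close>

lemma softmax_form_centered:
  fixes x y x' y' p :: "real^'k"
  defines "K \<equiv> real CARD('k)"
  assumes p: "\<And>j. p $ j = q + (if j = c then g else 0)" and one: "K * q + g = 1"
    and x: "\<And>j. x $ j = x' $ j + t" and y: "\<And>j. y $ j = y' $ j + t'"
    and x': "(\<Sum>j\<in>UNIV. x' $ j) = 0" and y': "(\<Sum>j\<in>UNIV. y' $ j) = 0"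
  shows "softmax_form p x y = q * (x' \<bullet> y' + K * g * (x' $ c * y' $ c))"
proof -
  have ps: "(\<Sum>j\<in>UNIV. p $ j * f j) = q * (\<Sum>j\<in>UNIV. f j) + g * f c" for f :: "'k \<Rightarrow> real"
    by (simp add: p distrib_right sum.distrib if_distrib[of "\<lambda>r. r * _"] flip: sum_distrib_left cong: if_cong)
  have "p \<bullet> x = q * (K * t) + g * (x' $ c + t)"
    using x' by (simp add: inner_vec_def ps x sum.distrib K_def)
  also have "\<dots> = (K * q + g) * t + g * x' $ c" by (simp add: algebra_simps)
  finally have 1: "p \<bullet> x = t + g * x' $ c" by (simp add: one)
  have "p \<bullet> y = q * (K * t') + g * (y' $ c + t')"
    using y' by (simp add: inner_vec_def ps y sum.distrib K_def)
  also have "\<dots> = (K * q + g) * t' + g * y' $ c" by (simp add: algebra_simps)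
  finally have 2: "p \<bullet> y = t' + g * y' $ c" by (simp add: one)
  have "(\<Sum>j\<in>UNIV. x $ j * y $ j) = x' \<bullet> y' + K * t * t'"
    using x' y' by (simp add: x y distrib_left distrib_right sum.distrib inner_vec_def K_def
        flip: sum_distrib_left sum_distrib_right)
  hence 3: "(\<Sum>j\<in>UNIV. p $ j * x $ j * y $ j) = q * (x' \<bullet> y' + K * t * t') + g * (x' $ c + t) * (y' $ c + t')"
    by (simp add: ps mult.assoc x y)
  have g: "g = 1 - K * q" using one by simp
  show ?thesis unfolding softmax_form_def 1 2 3 g by algebra
qed

lemma softmax_collapsed:
  fixes z :: "real^'k"
  defines "K \<equiv> real CARD('k)"
  assumes z: "\<And>j. z $ j = a * ((if j = c then 1 else 0) - 1 / K)"
  shows "softmax z $ j = 1 / (K - 1 + exp a) + (if j = c then 1 - K * (1 / (K - 1 + exp a)) else 0)"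
proof -
  \<comment> \<open>The factor common to all classes cancels in the softmax quotient.\<close>
  have e: "exp (z $ i) = exp (- a / K) * (1 + (if i = c then exp a - 1 else 0))" for i
    by (simp add: z right_diff_distrib exp_diff exp_minus divide_inverse)
  have s: "(\<Sum>i\<in>UNIV. exp (z $ i)) = exp (- a / K) * (K - 1 + exp a)"
    unfolding e sum_distrib_left[symmetric] by (simp add: sum.distrib K_def)
  have "K \<ge> 1" by (simp add: K_def Suc_leI)
  define D where "D = K - 1 + exp a"
  have "D > 0" using \<open>K \<ge> 1\<close> exp_gt_zero[of a] unfolding D_def by linarith
  hence D: "exp a / D = 1 / D + (1 - K * (1 / D))"
    by (simp add: D_def field_simps)
  show ?thesis
    unfolding softmax_def vec_lambda_beta s e[of j] D_def[symmetric] using D by simp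
qed

text \<open>The vertices of a regular simplex centred at the origin: their Gram matrix is the
  centring matrix.\<close>

definition centred_frame :: "('k \<Rightarrow> real^'d) \<Rightarrow> bool" where
  "centred_frame p \<longleftrightarrow> (\<forall>k l. p k \<bullet> p l = (if k = l then 1 else 0) - 1 / real CARD('k))"

lemma centred_frame_inner:
  fixes p :: "'k \<Rightarrow> real^'d"
  assumes "centred_frame p"
  shows "p k \<bullet> p l = (if k = l then 1 else 0) - 1 / real CARD('k)"
  using assms by (simp add: centred_frame_def)

lemma centred_frame_sum:
  fixes p :: "'k::finite \<Rightarrow> real^'d"
  assumes "centred_frame p"
  shows "(\<Sum>k\<in>UNIV. p k) = 0"
proof -
  have "(\<Sum>k\<in>UNIV. p k) \<bullet> (\<Sum>k\<in>UNIV. p k) = 0"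
    by (simp add: inner_sum_left inner_sum_right centred_frame_inner[OF assms] sum_subtractf)
  thus ?thesis by simp
qed

text \<open>The Gram matrix fixes sum-zero vectors, so synthesis with the frame is a right inverse
  of taking inner products with it on that subspace. This supplies the partial isometries for both
  Hessians.\<close>

lemma centred_frame_synthesis:
  fixes p :: "'k::finite \<Rightarrow> real^'d"
  assumes "centred_frame p" and "(\<Sum>k\<in>UNIV. U k) = 0"
  shows "p c \<bullet> (\<Sum>k\<in>UNIV. U k *\<^sub>R p k) = U c"
proof -
  have "p c \<bullet> (\<Sum>k\<in>UNIV. U k *\<^sub>R p k) = (\<Sum>k\<in>UNIV. U k * (if c = k then 1 else 0)) - (\<Sum>k\<in>UNIV. U k) / real CARD('k)"
    by (simp add: inner_sum_right centred_frame_inner[OF assms(1)] right_diff_distrib sum_subtractf sum_divide_distrib)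
  thus ?thesis using assms(2) by (simp add: if_distrib cong: if_cong)
qed

section \<open>Column blocks of vectorized matrices\<close>

definition block :: "real^('a::finite \<times> 'd::finite) \<Rightarrow> 'a \<Rightarrow> real^'d" where
  "block v a = column a (unvectorize v)"

lemma block_nth: "block v a $ i = v $ (a, i)"
  by (simp add: block_def column_def unvectorize_def)

lemma block_vectorize: "block (vectorize A) a = column a A"
  by (simp add: vec_eq_iff block_nth vectorize_def column_def)

lemma linear_block: "linear (\<lambda>v. block v a)"
  by (rule linearI) (simp_all add: vec_eq_iff block_nth)

lemma inner_eq_sum_block:
  "u \<bullet> v = (\<Sum>a\<in>UNIV. block u a \<bullet> block v a)"
  by (simp add: inner_vec_def block_nth sum.cartesian_product flip: UNIV_Times_UNIV)

lemma obtain_block: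
  obtains v where "\<And>a. block v a = F a"
proof
  show "block (\<chi> p. F (fst p) $ snd p) a = F a" for a
    by (simp add: vec_eq_iff block_nth)
qed

lemma transpose_mult_nth: "(transpose A ** B) $ i $ j = column i A \<bullet> column j B"
  by (simp add: matrix_matrix_mult_def transpose_def inner_vec_def column_def)

lemma sum_smoothed_label:
  "(\<Sum>j\<in>UNIV. column s (smoothed_label_mat \<delta> :: real^('k::finite \<times> 'n::finite)^'k) $ j) = 1"
  by (simp add: column_def smoothed_label_mat_def label_mat_def sum.distrib flip: sum_distrib_left)

lemma obtain_three:
  assumes "CARD('k::finite) \<ge> 3"
  obtains i j l :: "'k::finite" where "i \<noteq> j" "j \<noteq> l" "i \<noteq> l"
proof -
  obtain T :: "'k::finite set" where "card T = 3" using obtain_subset_with_card_n[OF assms] by blast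
  then obtain x y z where "T = {x, y, z}" "x \<noteq> y" "y \<noteq> z" "x \<noteq> z" unfolding card_3_iff by blast
  thus thesis using that by blast
qed

text \<open>The softmax probability of each wrong class at collapsed logits with parameter
  \<open>a\<close>.\<close>

definition collapsed_prob :: "nat \<Rightarrow> real \<Rightarrow> real" where
  "collapsed_prob K a = 1 / (real K - 1 + exp a)"

lemma collapsed_prob_pos:
  assumes "K \<ge> 1" "a > 0"
  shows "0 < collapsed_prob K a" "real K * collapsed_prob K a < 1"
proof -
  have "real K - 1 + exp a > real K" "real K - 1 + exp a > 0"
    using assms one_less_exp_iff[of a] by (auto simp del: one_less_exp_iff)
  thus "0 < collapsed_prob K a" "real K * collapsed_prob K a < 1"
    unfolding collapsed_prob_def by (simp_all add: pos_divide_less_eq)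
qed

lemma condition_number_hessian_W:
  fixes W :: "real^'k^'d" and H :: "real^('k::finite \<times> 'n::finite)^'d" and p :: "'k \<Rightarrow> real^'d"
  assumes card: "CARD('k) \<ge> 2" and fr: "centred_frame p"
    and W: "\<And>k. column k W = \<sigma> *\<^sub>R p k" and H: "\<And>s. column s H = \<tau> *\<^sub>R p (fst s)"
    and a: "\<sigma> * \<tau> = a" "a > 0"
  shows "condition_number (hessian_W \<delta> W H) = (if CARD('k) \<ge> 3
    then 1 + (real CARD('k) - 1) * (1 - real CARD('k) * collapsed_prob CARD('k) a) else 1)"
proof -
  define K where "K = real CARD('k)"
  have K: "K \<ge> 2" using card by (simp add: K_def)
  define q g where "q = collapsed_prob CARD('k) a" and "g = 1 - K * q"
  have q: "q > 0" "g > 0"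
    using collapsed_prob_pos[of "CARD('k)" a] card a(2) by (simp_all add: q_def g_def K_def)
  define N where "N = real CARD('k \<times> 'n)"
  have N: "N > 0" by (simp add: N_def)
  define n where "n = real CARD('n)"
  have n: "n > 0" by (simp add: n_def)
  \<comment> \<open>Adding one vector to all columns of \<open>W\<close> shifts each logit vector by
    a constant, which softmax does not see. Subtracting the mean block removes this direction from
    \<open>X\<close>.\<close>
  define mean where "mean v = (1 / K) *\<^sub>R (\<Sum>k\<in>UNIV. block v k)" for v :: "real^('k \<times> 'd)"
  define X where "X c v = (\<chi> k. (block v k - mean v) \<bullet> p c)" for c :: 'k and v
  define B where "B s v = (\<chi> k. block v k \<bullet> column s H)" for s :: "'k \<times> 'n" and v :: "real^('k \<times> 'd)"
  \<comment> \<open>The range consists of doubly centred arrays: over \<open>k\<close> because the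
    mean is removed, over \<open>c\<close> because the frame sums to zero.\<close>
  define R where "R U \<longleftrightarrow> (\<forall>c. (\<Sum>k\<in>UNIV. U c $ k) = 0) \<and> (\<forall>k. (\<Sum>c\<in>UNIV. U c $ k) = 0)"
    for U :: "'k \<Rightarrow> real^'k"
  have linB: "linear (B s)" for s
    by (rule linearI) (simp_all add: vec_eq_iff B_def linear_add[OF linear_block] linear_scale[OF linear_block] inner_add_left)
  have linM: "linear mean"
    by (rule linearI) (simp_all add: mean_def linear_add[OF linear_block] linear_scale[OF linear_block] sum.distrib
       scaleR_add_right scaleR_sum_right)
  have linX: "linear (X c)" for c
    by (rule linearI) (simp_all add: vec_eq_iff X_def linear_add[OF linear_block] linear_scale[OF linear_block]
        linear_add[OF linM] linear_scale[OF linM] inner_add_left inner_diff_left algebra_simps)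
  have mean0: "(\<Sum>k\<in>UNIV. block v k - mean v) = 0" for v
    using K by (simp add: sum_subtractf mean_def K_def sum_constant_scaleR del: sum_constant)
  have X0: "(\<Sum>k\<in>UNIV. X c v $ k) = 0" for c v
    by (simp add: X_def mean0 flip: inner_sum_left)
  have X0': "(\<Sum>c\<in>UNIV. X c v $ k) = 0" for k v
    by (simp add: X_def centred_frame_sum[OF fr] flip: inner_sum_right)
  have loss: "empirical_loss \<delta> (unvectorize v) H = (\<Sum>s\<in>UNIV. ce_loss (B s v) (column s (smoothed_label_mat \<delta>))) / N" for v
  proof -
    have "column s (transpose (unvectorize v) ** H) = B s v" for s
      by (simp add: vec_eq_iff column_def[of s "transpose _ ** _"] transpose_mult_nth B_def block_def)
    thus ?thesis by (simp add: empirical_loss_def ce_loss_mat_def N_def)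
  qed
  have soft: "softmax (B s (vectorize W)) $ j = q + (if j = fst s then g else 0)" for s j
    unfolding q_def g_def collapsed_prob_def K_def
    by (rule softmax_collapsed) (simp add: B_def block_vectorize W H centred_frame_inner[OF fr] a(1)[symmetric])
  have BX: "B s v $ j = \<tau> * X (fst s) v $ j + \<tau> * (mean v \<bullet> p (fst s))" for s v j
    by (simp add: B_def H X_def inner_diff_left right_diff_distrib)
  have form: "softmax_form (softmax (B s (vectorize W))) (B s u) (B s v)
     = q * \<tau>\<^sup>2 * (X (fst s) u \<bullet> X (fst s) v + K * g * (X (fst s) u $ fst s * X (fst s) v $ fst s))" for s u v
  proof -
    have "softmax_form (softmax (B s (vectorize W))) (B s u) (B s v)
      = q * ((\<tau> *\<^sub>R X (fst s) u) \<bullet> (\<tau> *\<^sub>R X (fst s) v)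
         + real CARD('k) * g * ((\<tau> *\<^sub>R X (fst s) u) $ fst s * (\<tau> *\<^sub>R X (fst s) v) $ fst s))"
      by (rule softmax_form_centered[OF soft, where t = "\<tau> * (mean u \<bullet> p (fst s))" and t' = "\<tau> * (mean v \<bullet> p (fst s))"])
        (simp_all add: g_def K_def X0 BX flip: sum_distrib_left)
    thus ?thesis by (simp add: K_def power2_eq_square algebra_simps)
  qed
  have hess: "u \<bullet> (hessian_W \<delta> W H *v v) = n * q * \<tau>\<^sup>2 / N *
      (\<Sum>c\<in>UNIV. X c u \<bullet> X c v + K * g * (X c u $ id c * X c v $ id c))" for u v
  proof -
    have "u \<bullet> (hessian_W \<delta> W H *v v)
      = (\<Sum>s\<in>UNIV. softmax_form (softmax (B s (vectorize W))) (B s u) (B s v)) / N"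
      unfolding hessian_W_def loss by (rule hessian_ce[OF linB sum_smoothed_label])
    \<comment> \<open>The form depends on a sample only through its class, so each class contributes
      \<open>CARD('n)\<close> equal terms.\<close>
    also have "(\<Sum>s\<in>UNIV. softmax_form (softmax (B s (vectorize W))) (B s u) (B s v))
      = (\<Sum>c\<in>UNIV. \<Sum>i\<in>(UNIV :: 'n set). q * \<tau>\<^sup>2 * (X c u \<bullet> X c v + K * g * (X c u $ c * X c v $ c)))"
      unfolding form sum.cartesian_product UNIV_Times_UNIV by (simp add: case_prod_beta)
    finally show ?thesis by (simp add: n_def mult_ac flip: sum_distrib_left)
  qed
  have "condition_number (hessian_W \<delta> W H) = (if CARD('k) \<ge> 3 then 1 + (real CARD('k) - 1) * g else 1)"
  proof (rule condition_number_partial_isometry[where X = X and R = R and f = id, OF hess[unfolded K_def]])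
    show "n * q * \<tau>\<^sup>2 / N > 0"
      using n q N a by (auto intro!: mult_pos_pos divide_pos_pos)
    show "R (\<lambda>s. X s v)" for v by (simp add: R_def X0 X0')
    show "(\<Sum>k\<in>UNIV. U s $ k) = 0" if "R U" for U s using that by (simp add: R_def)
    show "\<exists>v. (\<forall>s. X s v = U s) \<and> (\<forall>u. u \<bullet> v = (\<Sum>s\<in>UNIV. X s u \<bullet> U s))" if "R U" for U
    proof -
      have U: "(\<Sum>k\<in>UNIV. U c $ k) = 0" "(\<Sum>c\<in>UNIV. U c $ k) = 0" for c k using that by (auto simp: R_def)
      obtain v where v: "\<And>k. block v k = (\<Sum>c\<in>UNIV. U c $ k *\<^sub>R p c)"
        using obtain_block[of "\<lambda>k. \<Sum>c\<in>UNIV. U c $ k *\<^sub>R p c"] by blast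
      have "(\<Sum>k\<in>UNIV. block v k) = (\<Sum>c\<in>UNIV. (\<Sum>k\<in>UNIV. U c $ k) *\<^sub>R p c)"
        unfolding v scaleR_sum_left by (rule sum.swap)
      hence m: "mean v = 0" by (simp add: mean_def U)
      have "X c v = U c" for c
        by (simp add: vec_eq_iff X_def m v inner_commute[of _ "p c"] centred_frame_synthesis[OF fr] U)
      moreover have "u \<bullet> v = (\<Sum>c\<in>UNIV. X c u \<bullet> U c)" for u
      proof -
        have "(\<Sum>c\<in>UNIV. X c u \<bullet> U c) = (\<Sum>c\<in>UNIV. \<Sum>k\<in>UNIV. U c $ k * (block u k \<bullet> p c)) - (\<Sum>c\<in>UNIV. (\<Sum>k\<in>UNIV. U c $ k) * (mean u \<bullet> p c))"
          by (simp add: inner_vec_def[of _ "U _"] X_def inner_diff_left right_diff_distrib sum_subtractf mult.commute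
             flip: sum_distrib_left sum_distrib_right)
        also have "\<dots> = (\<Sum>k\<in>UNIV. \<Sum>c\<in>UNIV. U c $ k * (block u k \<bullet> p c))"
          unfolding U(1) by simp (rule sum.swap)
        also have "\<dots> = u \<bullet> v" by (simp add: inner_eq_sum_block v inner_sum_right)
        finally show ?thesis by simp
      qed
      ultimately show ?thesis by blast
    qed
    show "R (\<lambda>s. \<chi> k. (if k = id s then 1 else 0) - 1 / real CARD('k))"
      by (simp add: R_def sum_subtractf)
    show "\<exists>U. R U \<and> (\<exists>s. U s \<noteq> 0) \<and> (\<forall>s. U s $ id s = 0)" if three: "3 \<le> CARD('k)"
    proof -
      obtain i j l :: 'k where d: "i \<noteq> j" "j \<noteq> l" "i \<noteq> l" using obtain_three[OF three] .
      define x y :: "real^'k" where "x = axis i 1 - axis l 1" and "y = axis j 1 - axis l 1"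
      have s: "(\<Sum>k\<in>UNIV. x $ k) = 0" "(\<Sum>k\<in>UNIV. y $ k) = 0"
        by (simp_all add: x_def y_def sum_subtractf axis_def)
      \<comment> \<open>The antisymmetric array x y^T - y x^T has zero diagonal, and its row and
        column sums vanish because those of \<open>x\<close> and \<open>y\<close> do. Three distinct
        classes make it nonzero.\<close>
      define U :: "'k \<Rightarrow> real^'k" where "U = (\<lambda>c. x $ c *\<^sub>R y - y $ c *\<^sub>R x)"
      have "R U" by (simp add: R_def U_def sum_subtractf s flip: sum_distrib_left sum_distrib_right)
      moreover have "U i $ j = 1" using d by (simp add: U_def x_def y_def axis_def)
      hence "U i \<noteq> 0" by auto
      moreover have "U c $ c = 0" for c by (simp add: U_def)
      ultimately show ?thesis by auto
    qed
  qed (use q card linX in auto)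
  thus ?thesis by (simp add: g_def q_def K_def)
qed

lemma condition_number_hessian_H:
  fixes W :: "real^'k^'d" and H :: "real^('k::finite \<times> 'n::finite)^'d" and p :: "'k \<Rightarrow> real^'d"
  assumes card: "CARD('k) \<ge> 2" and fr: "centred_frame p"
    and W: "\<And>k. column k W = \<sigma> *\<^sub>R p k" and H: "\<And>s. column s H = \<tau> *\<^sub>R p (fst s)"
    and a: "\<sigma> * \<tau> = a" "a > 0"
  shows "condition_number (hessian_H \<delta> W H) = (if CARD('k) \<ge> 3
    then 1 + (real CARD('k) - 1) * (1 - real CARD('k) * collapsed_prob CARD('k) a) else 1)"
proof -
  define K where "K = real CARD('k)"
  have K: "K \<ge> 2" using card by (simp add: K_def)
  define q g where "q = collapsed_prob CARD('k) a" and "g = 1 - K * q"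
  have q: "q > 0" "g > 0"
    using collapsed_prob_pos[of "CARD('k)" a] card a(2) by (simp_all add: q_def g_def K_def)
  define N where "N = real CARD('k \<times> 'n)"
  have N: "N > 0" by (simp add: N_def)
  \<comment> \<open>Each sample has its own block and the frame sums to zero, so these vectors are
    already centred; unlike for \<open>W\<close>, no condition links different samples.\<close>
  define X where "X s v = (\<chi> k. p k \<bullet> block v s)" for s :: "'k \<times> 'n" and v :: "real^(('k \<times> 'n) \<times> 'd)"
  define R where "R U \<longleftrightarrow> (\<forall>s. (\<Sum>k\<in>UNIV. U s $ k) = 0)" for U :: "'k \<times> 'n \<Rightarrow> real^'k"
  have linX: "linear (X s)" for s
    by (rule linearI) (simp_all add: vec_eq_iff X_def linear_add[OF linear_block] linear_scale[OF linear_block] inner_add_right)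
  have linB: "linear (\<lambda>v. \<sigma> *\<^sub>R X s v)" for s
    by (rule linear_compose_scale_right[OF linX])
  have X0: "(\<Sum>k\<in>UNIV. X s v $ k) = 0" for s v
    by (simp add: X_def centred_frame_sum[OF fr] flip: inner_sum_left)
  have loss: "empirical_loss \<delta> W (unvectorize v) = (\<Sum>s\<in>UNIV. ce_loss (\<sigma> *\<^sub>R X s v) (column s (smoothed_label_mat \<delta>))) / N" for v
  proof -
    have "column s (transpose W ** unvectorize v) = \<sigma> *\<^sub>R X s v" for s
      by (simp add: vec_eq_iff column_def[of s "transpose _ ** _"] transpose_mult_nth W X_def block_def)
    thus ?thesis by (simp add: empirical_loss_def ce_loss_mat_def N_def)
  qed
  have soft: "softmax (\<sigma> *\<^sub>R X s (vectorize H)) $ j = q + (if j = fst s then g else 0)" for s j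
    unfolding q_def g_def collapsed_prob_def K_def
    by (rule softmax_collapsed) (simp add: X_def block_vectorize H centred_frame_inner[OF fr] a(1)[symmetric])
  have form: "softmax_form (softmax (\<sigma> *\<^sub>R X s (vectorize H))) (\<sigma> *\<^sub>R X s u) (\<sigma> *\<^sub>R X s v)
     = q * \<sigma>\<^sup>2 * (X s u \<bullet> X s v + K * g * (X s u $ fst s * X s v $ fst s))" for s u v
  proof -
    have "softmax_form (softmax (\<sigma> *\<^sub>R X s (vectorize H))) (\<sigma> *\<^sub>R X s u) (\<sigma> *\<^sub>R X s v)
      = q * ((\<sigma> *\<^sub>R X s u) \<bullet> (\<sigma> *\<^sub>R X s v)
         + real CARD('k) * g * ((\<sigma> *\<^sub>R X s u) $ fst s * (\<sigma> *\<^sub>R X s v) $ fst s))"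
      by (rule softmax_form_centered[OF soft, where t = 0 and t' = 0])
        (simp_all add: g_def K_def X0 flip: sum_distrib_left)
    thus ?thesis by (simp add: K_def power2_eq_square algebra_simps)
  qed
  have hess: "u \<bullet> (hessian_H \<delta> W H *v v) = q * \<sigma>\<^sup>2 / N *
      (\<Sum>s\<in>UNIV. X s u \<bullet> X s v + K * g * (X s u $ fst s * X s v $ fst s))" for u v
  proof -
    have "u \<bullet> (hessian_H \<delta> W H *v v)
      = (\<Sum>s\<in>UNIV. softmax_form (softmax (\<sigma> *\<^sub>R X s (vectorize H))) (\<sigma> *\<^sub>R X s u) (\<sigma> *\<^sub>R X s v)) / N"
      unfolding hessian_H_def loss by (rule hessian_ce[OF linB sum_smoothed_label])
    thus ?thesis unfolding form by (simp flip: sum_distrib_left)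
  qed
  have "condition_number (hessian_H \<delta> W H) = (if CARD('k) \<ge> 3 then 1 + (real CARD('k) - 1) * g else 1)"
  proof (rule condition_number_partial_isometry[where X = X and R = R and f = fst, OF hess[unfolded K_def]])
    show "q * \<sigma>\<^sup>2 / N > 0"
      using q N a by (auto intro!: mult_pos_pos divide_pos_pos)
    show "R (\<lambda>s. X s v)" for v by (simp add: R_def X0)
    show "(\<Sum>k\<in>UNIV. U s $ k) = 0" if "R U" for U s using that unfolding R_def by blast
    show "\<exists>v. (\<forall>s. X s v = U s) \<and> (\<forall>u. u \<bullet> v = (\<Sum>s\<in>UNIV. X s u \<bullet> U s))" if "R U" for U
    proof -
      obtain v where v: "\<And>s. block v s = (\<Sum>k\<in>UNIV. U s $ k *\<^sub>R p k)"
        using obtain_block[of "\<lambda>s. \<Sum>k\<in>UNIV. U s $ k *\<^sub>R p k"] by blast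
      have "X s v = U s" for s
      proof -
        have "(\<Sum>k\<in>UNIV. U s $ k) = 0" using that unfolding R_def by blast
        thus ?thesis by (simp add: vec_eq_iff X_def v centred_frame_synthesis[OF fr])
      qed
      moreover have "u \<bullet> v = (\<Sum>s\<in>UNIV. X s u \<bullet> U s)" for u
        by (simp add: inner_eq_sum_block v inner_sum_right inner_vec_def[of _ "U _"] X_def inner_commute[of "p _"] mult.commute)
      ultimately show ?thesis by blast
    qed
    show "R (\<lambda>s. \<chi> k. (if k = fst s then 1 else 0) - 1 / real CARD('k))"
      by (simp add: R_def sum_subtractf)
    show "\<exists>U. R U \<and> (\<exists>s. U s \<noteq> 0) \<and> (\<forall>s. U s $ fst s = 0)" if three: "3 \<le> CARD('k)"
    proof -
      obtain i j l :: 'k where d: "i \<noteq> j" "j \<noteq> l" "i \<noteq> l" using obtain_three[OF three] .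
      \<comment> \<open>Supported on the samples of class \<open>l\<close> and on the two other
        classes \<open>i\<close> and \<open>j\<close>, so that every target entry is zero. Below,
        \<open>undefined\<close> merely names some sample of the class.\<close>
      define U :: "'k \<times> 'n \<Rightarrow> real^'k" where "U = (\<lambda>s. if fst s = l then axis i 1 - axis j 1 else 0)"
      have "R U" by (simp add: R_def U_def sum_subtractf axis_def)
      moreover have "U (l, undefined) $ i = 1" using d by (simp add: U_def axis_def)
      hence "U (l, undefined) \<noteq> 0" by auto
      moreover have "U s $ fst s = 0" for s using d by (simp add: U_def axis_def)
      ultimately show ?thesis by blast
    qed
  qed (use q card linX in auto)
  thus ?thesis by (simp add: g_def q_def K_def)
qed

section \<open>Global minimizers\<close>

definition mean_column :: "real^'k^'d \<Rightarrow> real^'d" where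
  "mean_column W = (1 / real CARD('k)) *\<^sub>R (\<Sum>k\<in>UNIV. column k W)"

definition collapsed_logits :: "real \<Rightarrow> 'k \<Rightarrow> real^'k" where
  "collapsed_logits a c = (\<chi> j. a * ((if j = c then 1 else 0) - 1 / real CARD('k)))"

definition logits :: "real^'k^'d \<Rightarrow> real^'s^'d \<Rightarrow> real^'k \<Rightarrow> 's \<Rightarrow> real^'k" where
  "logits W H b s = (\<chi> k. column k W \<bullet> column s H + b $ k)"

text \<open>Each summand measures one defect: wrong logits, uncentred columns of \<open>W\<close>,
  columns of \<open>H\<close> not proportional to the centred class columns of \<open>W\<close> with
  factor \<open>\<mu>\<close>, and nonzero bias.\<close>

definition excess_loss ::
  "real \<Rightarrow> real \<Rightarrow> real \<Rightarrow> real \<Rightarrow> real \<Rightarrow> real^'k^'d \<Rightarrow> real^('k::finite \<times> 'n::finite)^'d \<Rightarrow> real^'k \<Rightarrow> real" where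
  "excess_loss lW lH lb \<mu> a W H b =
     (\<Sum>s\<in>UNIV. bregman (logits W H b s) (collapsed_logits a (fst s))) / real CARD('k \<times> 'n)
     + lW / 2 * real CARD('k) * (norm (mean_column W))\<^sup>2
     + lH / 2 * (\<Sum>s\<in>UNIV. (norm (column s H - \<mu> *\<^sub>R (column (fst s) W - mean_column W)))\<^sup>2)
     + lb / 2 * (norm b)\<^sup>2"

lemma norm_matrix_sq: "(norm (A :: real^'c^'r))\<^sup>2 = (\<Sum>j\<in>UNIV. (norm (column j A))\<^sup>2)"
  unfolding power2_norm_eq_inner inner_vec_def inner_real_def
  by (simp add: column_def) (rule sum.swap)

lemma sum_prod_fst: "(\<Sum>s\<in>(UNIV :: ('k::finite \<times> 'n::finite) set). f (fst s)) = real CARD('n) * (\<Sum>k\<in>UNIV. f k :: real)"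
proof -
  have "(\<Sum>s\<in>(UNIV :: ('k \<times> 'n) set). f (fst s)) = (\<Sum>k\<in>UNIV. \<Sum>i\<in>(UNIV :: 'n set). f k)"
    unfolding sum.cartesian_product UNIV_Times_UNIV by (simp add: case_prod_beta)
  thus ?thesis by (simp add: sum_distrib_left)
qed

lemma sum_norm_centred_columns:
  fixes W :: "real^'k^'d"
  shows "(norm W)\<^sup>2 = (\<Sum>k\<in>UNIV. (norm (column k W - mean_column W))\<^sup>2) + real CARD('k) * (norm (mean_column W))\<^sup>2"
proof -
  have s: "(\<Sum>k\<in>UNIV. column k W) = real CARD('k) *\<^sub>R mean_column W"
    by (simp add: mean_column_def)
  have "(\<Sum>k\<in>UNIV. (norm (column k W - mean_column W))\<^sup>2)
     = (\<Sum>k\<in>UNIV. (norm (column k W))\<^sup>2) - 2 * ((\<Sum>k\<in>UNIV. column k W) \<bullet> mean_column W)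
       + real CARD('k) * (norm (mean_column W))\<^sup>2"
    unfolding power2_norm_eq_inner
    by (simp add: inner_diff_left inner_diff_right inner_commute[of "mean_column W" "column _ W"] sum.distrib sum_subtractf
        inner_sum_left sum_distrib_left)
  thus ?thesis unfolding s norm_matrix_sq by (simp add: power2_norm_eq_inner)
qed

text \<open>The first-order expansion of the cross-entropy at the collapsed logits has gradient
  proportional to the centred labels, so completing the squares leaves only nonnegative terms.\<close>

lemma regularized_loss_eq_excess:
  fixes W :: "real^'k^'d" and H :: "real^('k::finite \<times> 'n::finite)^'d" and b :: "real^'k"
  assumes lH: "lH > 0" and \<mu>: "lH * real CARD('n) * \<mu>\<^sup>2 = lW"
    and grad: "\<And>s j. softmax (collapsed_logits a (fst s)) $ j
      - column s (smoothed_label_mat \<delta> :: real^('k \<times> 'n)^'k) $ j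
      = - (real CARD('k \<times> 'n) * lH * \<mu>) * ((if j = fst s then 1 else 0) - 1 / real CARD('k))"
  shows "regularized_loss lW lH lb \<delta> W H b =
     (\<Sum>s\<in>UNIV. ce_loss (collapsed_logits a (fst s)) (column s (smoothed_label_mat \<delta> :: real^('k \<times> 'n)^'k))
        - (softmax (collapsed_logits a (fst s)) - column s (smoothed_label_mat \<delta> :: real^('k \<times> 'n)^'k))
          \<bullet> collapsed_logits a (fst s)) / real CARD('k \<times> 'n)
     + excess_loss lW lH lb \<mu> a W H b"
proof -
  define K where "K = real CARD('k)"
  define n where "n = real CARD('n)"
  define N where "N = real CARD('k \<times> 'n)"
  have K: "K > 0" and N: "N > 0" by (simp_all add: K_def N_def)
  let ?y = "\<lambda>s. column s (smoothed_label_mat \<delta> :: real^('k \<times> 'n)^'k)"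
  let ?z = "\<lambda>s :: 'k \<times> 'n. collapsed_logits a (fst s)"
  let ?Z = "logits W H b"
  define m where "m = mean_column W"
  define w where "w k = column k W - m" for k
  have Z: "column s (transpose W ** H + (\<chi> j s. b $ j)) = ?Z s" for s
    by (simp add: vec_eq_iff column_def[of s "_ + _"] transpose_mult_nth logits_def)
  have "ce_loss (?Z s) (?y s) = (ce_loss (?z s) (?y s) - (softmax (?z s) - ?y s) \<bullet> ?z s)
      + (softmax (?z s) - ?y s) \<bullet> ?Z s + bregman (?Z s) (?z s)" for s
    unfolding bregman_def ce_loss_eq[OF sum_smoothed_label] by (simp add: inner_diff_left inner_diff_right)
  \<comment> \<open>By \<open>grad\<close> the gradient is a multiple of the centred class
    indicator. Pairing it with the logits subtracts their average over the classes, which replaces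
    the columns of \<open>W\<close> by the centred \<open>w\<close>.\<close>
  moreover have "(softmax (?z s) - ?y s) \<bullet> ?Z s
     = - (N * lH * \<mu>) * (w (fst s) \<bullet> column s H + (b $ fst s - (\<Sum>j\<in>UNIV. b $ j) / K))" for s
  proof -
    have "(softmax (?z s) - ?y s) \<bullet> ?Z s
      = - (N * lH * \<mu>) * (\<Sum>j\<in>UNIV. ((if j = fst s then 1 else 0) - 1 / K) * ?Z s $ j)"
      by (simp add: inner_vec_def grad sum_distrib_left mult.assoc N_def K_def)
    also have "(\<Sum>j\<in>UNIV. ((if j = fst s then 1 else 0) - 1 / K) * ?Z s $ j)
      = ?Z s $ fst s - (\<Sum>j\<in>UNIV. ?Z s $ j) / K"
      by (simp add: left_diff_distrib sum_subtractf if_distrib[of "\<lambda>r. r * _"] sum_divide_distrib cong: if_cong)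
    also have "(\<Sum>j\<in>UNIV. ?Z s $ j) = K * (m \<bullet> column s H) + (\<Sum>j\<in>UNIV. b $ j)"
      using K by (simp add: logits_def sum.distrib m_def mean_column_def K_def inner_sum_left)
    finally show ?thesis
      using K by (simp add: logits_def w_def inner_diff_left add_divide_distrib)
  qed
  ultimately have "(\<Sum>s\<in>UNIV. ce_loss (?Z s) (?y s)) = (\<Sum>s\<in>UNIV. ce_loss (?z s) (?y s) - (softmax (?z s) - ?y s) \<bullet> ?z s)
     - (N * lH * \<mu>) * (\<Sum>s\<in>UNIV. w (fst s) \<bullet> column s H + (b $ fst s - (\<Sum>j\<in>UNIV. b $ j) / K))
     + (\<Sum>s\<in>UNIV. bregman (?Z s) (?z s))"
    by (simp add: sum.distrib sum_subtractf sum_negf flip: sum_distrib_left)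
  \<comment> \<open>The classes are balanced, so the centred biases cancel in the sum over all
    samples.\<close>
  also have "(\<Sum>s\<in>(UNIV :: ('k \<times> 'n) set). w (fst s) \<bullet> column s H + (b $ fst s - (\<Sum>j\<in>UNIV. b $ j) / K))
      = (\<Sum>s\<in>UNIV. w (fst s) \<bullet> column s H)"
    unfolding sum.distrib sum_prod_fst[of "\<lambda>k. b $ k - (\<Sum>j\<in>UNIV. b $ j) / K"] by (simp add: sum_subtractf K_def)
  finally have ce: "(\<Sum>s\<in>UNIV. ce_loss (?Z s) (?y s)) / N
     = (\<Sum>s\<in>UNIV. ce_loss (?z s) (?y s) - (softmax (?z s) - ?y s) \<bullet> ?z s) / N
     - lH * \<mu> * (\<Sum>s\<in>UNIV. w (fst s) \<bullet> column s H) + (\<Sum>s\<in>UNIV. bregman (?Z s) (?z s)) / N"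
    using N by (simp add: add_divide_distrib diff_divide_distrib)
  have "(norm (column s H - \<mu> *\<^sub>R w (fst s)))\<^sup>2
      = (norm (column s H))\<^sup>2 - 2 * \<mu> * (w (fst s) \<bullet> column s H) + \<mu>\<^sup>2 * (norm (w (fst s)))\<^sup>2" for s
    unfolding power2_norm_eq_inner
    by (simp add: inner_diff_left inner_diff_right inner_commute[of "column _ _" "w _"] power2_eq_square algebra_simps)
  hence "(\<Sum>s\<in>UNIV. (norm (column s H - \<mu> *\<^sub>R w (fst s)))\<^sup>2)
     = (norm H)\<^sup>2 - 2 * \<mu> * (\<Sum>s\<in>UNIV. w (fst s) \<bullet> column s H) + \<mu>\<^sup>2 * (\<Sum>s\<in>(UNIV :: ('k \<times> 'n) set). (norm (w (fst s)))\<^sup>2)"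
    by (simp add: norm_matrix_sq sum.distrib sum_subtractf sum_distrib_left)
  also have "(\<Sum>s\<in>(UNIV :: ('k \<times> 'n) set). (norm (w (fst s)))\<^sup>2) = n * (\<Sum>k\<in>UNIV. (norm (w k))\<^sup>2)"
    unfolding n_def by (rule sum_prod_fst)
  finally have sum_sq: "(\<Sum>s\<in>UNIV. (norm (column s H - \<mu> *\<^sub>R w (fst s)))\<^sup>2)
     = (norm H)\<^sup>2 - 2 * \<mu> * (\<Sum>s\<in>UNIV. w (fst s) \<bullet> column s H) + \<mu>\<^sup>2 * (n * (\<Sum>k\<in>UNIV. (norm (w k))\<^sup>2))" .
  \<comment> \<open>The cross term is exactly the linear term in \<open>ce\<close>, and by the
    assumption on \<open>\<mu>\<close> the last coefficient is lW / 2, matching the centred part of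
    the penalty on \<open>W\<close>.\<close>
  have sq: "lH / 2 * (\<Sum>s\<in>UNIV. (norm (column s H - \<mu> *\<^sub>R w (fst s)))\<^sup>2)
     = lH / 2 * (norm H)\<^sup>2 - lH * \<mu> * (\<Sum>s\<in>UNIV. w (fst s) \<bullet> column s H)
       + (lH * n * \<mu>\<^sup>2) / 2 * (\<Sum>k\<in>UNIV. (norm (w k))\<^sup>2)"
    unfolding sum_sq by (simp add: field_simps)
  have wW: "lW / 2 * (norm W)\<^sup>2 = lW / 2 * (\<Sum>k\<in>UNIV. (norm (w k))\<^sup>2) + lW / 2 * K * (norm m)\<^sup>2"
    unfolding sum_norm_centred_columns[of W] w_def m_def K_def by (simp add: algebra_simps)
  show ?thesis
    using ce sq[unfolded \<mu>[folded n_def]] wW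
    unfolding regularized_loss_def excess_loss_def ce_loss_mat_def Z N_def[symmetric] K_def[symmetric]
      m_def[symmetric] w_def[symmetric]
    by linarith
qed

lemma excess_loss_nonneg:
  assumes "lW > 0" "lH > 0" "lb > 0"
  shows "0 \<le> excess_loss lW lH lb \<mu> a W H b"
  using assms unfolding excess_loss_def
  by (intro add_nonneg_nonneg mult_nonneg_nonneg divide_nonneg_nonneg sum_nonneg) (simp_all add: bregman_nonneg)

lemma excess_loss_eq_0_iff:
  fixes W :: "real^'k^'d" and H :: "real^('k::finite \<times> 'n::finite)^'d"
  assumes "lW > 0" "lH > 0" "lb > 0"
  shows "excess_loss lW lH lb \<mu> a W H b = 0 \<longleftrightarrow>
    (\<forall>s. bregman (logits W H b s) (collapsed_logits a (fst s)) = 0) \<and> mean_column W = 0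
    \<and> (\<forall>s. column s H = \<mu> *\<^sub>R column (fst s) W) \<and> b = 0"
proof -
  let ?A = "(\<Sum>s\<in>UNIV. bregman (logits W H b s) (collapsed_logits a (fst s))) / real CARD('k \<times> 'n)"
  let ?B = "lW / 2 * real CARD('k) * (norm (mean_column W))\<^sup>2"
  let ?C = "lH / 2 * (\<Sum>s\<in>UNIV. (norm (column s H - \<mu> *\<^sub>R (column (fst s) W - mean_column W)))\<^sup>2)"
  let ?D = "lb / 2 * (norm b)\<^sup>2"
  have nn: "0 \<le> ?A" "0 \<le> ?B" "0 \<le> ?C" "0 \<le> ?D"
    using assms by (simp_all add: sum_nonneg bregman_nonneg)
  have "excess_loss lW lH lb \<mu> a W H b = 0 \<longleftrightarrow> ?A = 0 \<and> ?B = 0 \<and> ?C = 0 \<and> ?D = 0"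
    using nn unfolding excess_loss_def by linarith
  also have "?A = 0 \<longleftrightarrow> (\<forall>s. bregman (logits W H b s) (collapsed_logits a (fst s)) = 0)"
    by (simp add: sum_nonneg_eq_0_iff bregman_nonneg)
  also have "?B = 0 \<longleftrightarrow> mean_column W = 0" using assms by simp
  also have "?C = 0 \<longleftrightarrow> (\<forall>s. column s H = \<mu> *\<^sub>R (column (fst s) W - mean_column W))"
    using assms by (simp add: sum_nonneg_eq_0_iff)
  also have "?D = 0 \<longleftrightarrow> b = 0" using assms by simp
  finally show ?thesis by auto
qed

text \<open>Vanishing logit defects prescribe the Gram matrix of the columns of \<open>W\<close> up
  to one shift per class; the columns summing to zero excludes the shifts, and dividing by
  \<open>\<sigma>\<close> normalizes the Gram matrix to the centring matrix.\<close>

lemma excess_loss_eq_0_iff_frame: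
  fixes W :: "real^'k^'d" and H :: "real^('k::finite \<times> 'n::finite)^'d"
  assumes "lW > 0" "lH > 0" "lb > 0"
    and \<mu>: "\<mu> > 0" and \<sigma>: "\<sigma> > 0" "\<mu> * \<sigma>\<^sup>2 = a"
  shows "excess_loss lW lH lb \<mu> a W H b = 0 \<longleftrightarrow>
    (\<exists>p. centred_frame p \<and> (\<forall>k. column k W = \<sigma> *\<^sub>R p k) \<and> (\<forall>s. column s H = (\<mu> * \<sigma>) *\<^sub>R p (fst s)) \<and> b = 0)"
  unfolding excess_loss_eq_0_iff[OF assms(1-3)]
proof (intro iffI; elim exE conjE)
  assume br: "\<forall>s. bregman (logits W H b s) (collapsed_logits a (fst s)) = 0" and m: "mean_column W = 0"
    and H: "\<forall>s. column s H = \<mu> *\<^sub>R column (fst s) W" and b: "b = 0"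
  have sum0: "(\<Sum>k\<in>UNIV. column k W) = 0" using m by (simp add: mean_column_def)
  have ww: "\<mu> * (column k W \<bullet> column l W) = a * ((if k = l then 1 else 0) - 1 / real CARD('k))" for k l
  proof -
    obtain t where t: "\<And>j. logits W H b (l, undefined) $ j = collapsed_logits a l $ j + t"
      using br[rule_format, of "(l, undefined)"] unfolding bregman_eq_0_iff by auto
    hence t': "\<mu> * (column j W \<bullet> column l W) = a * ((if j = l then 1 else 0) - 1 / real CARD('k)) + t" for j
      using H b by (simp add: logits_def collapsed_logits_def)
    \<comment> \<open>Summing over \<open>j\<close> annihilates the inner products and the centred
      indicator alike, so K t = 0.\<close>
    have "(\<Sum>j\<in>UNIV. \<mu> * (column j W \<bullet> column l W)) = 0"
      by (simp add: sum0 flip: sum_distrib_left inner_sum_left)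
    hence "t = 0"
      unfolding t' by (simp add: sum.distrib sum_subtractf flip: sum_distrib_left)
    thus ?thesis using t' by simp
  qed
  define p where "p k = (1 / \<sigma>) *\<^sub>R column k W" for k
  have "p k \<bullet> p l = (if k = l then 1 else 0) - 1 / real CARD('k)" for k l
  proof -
    have "a * (p k \<bullet> p l) = \<mu> * (column k W \<bullet> column l W)"
      using \<sigma>(1) by (simp add: p_def power2_eq_square flip: \<sigma>(2))
    moreover have "a \<noteq> 0" using \<mu> \<sigma> by auto
    ultimately show ?thesis unfolding ww by simp
  qed
  hence "centred_frame p" by (simp add: centred_frame_def)
  moreover have "column k W = \<sigma> *\<^sub>R p k" for k using \<sigma> by (simp add: p_def)
  ultimately show "\<exists>p. centred_frame p \<and> (\<forall>k. column k W = \<sigma> *\<^sub>R p k) \<and> (\<forall>s. column s H = (\<mu> * \<sigma>) *\<^sub>R p (fst s)) \<and> b = 0"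
    using H b by (intro exI[of _ p]) auto
next
  fix p :: "'k \<Rightarrow> real^'d"
  assume p: "centred_frame p" and W: "\<forall>k. column k W = \<sigma> *\<^sub>R p k"
    and H: "\<forall>s. column s H = (\<mu> * \<sigma>) *\<^sub>R p (fst s)" and b: "b = 0"
  have "logits W H b s $ k = collapsed_logits a (fst s) $ k" for s k
    using W[rule_format, of k] H[rule_format, of s] b
    by (simp add: logits_def collapsed_logits_def centred_frame_inner[OF p] power2_eq_square flip: \<sigma>(2))
  hence "logits W H b s = collapsed_logits a (fst s)" for s
    by (simp add: vec_eq_iff)
  moreover have "mean_column W = 0"
    using W by (simp add: mean_column_def centred_frame_sum[OF p] flip: scaleR_sum_right)
  ultimately show "(\<forall>s. bregman (logits W H b s) (collapsed_logits a (fst s)) = 0) \<and> mean_column W = 0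
    \<and> (\<forall>s. column s H = \<mu> *\<^sub>R column (fst s) W) \<and> b = 0"
    using W H b by (auto simp: bregman_def)
qed

section \<open>Orthonormal columns and centred frames\<close>

lemma orthonormal_columns_iff:
  fixes P :: "real^'k^'d"
  shows "transpose P ** P = mat 1 \<longleftrightarrow> (\<forall>k l. column k P \<bullet> column l P = (if k = l then 1 else 0))"
  by (auto simp: vec_eq_iff transpose_mult_nth mat_def)

lemma column_centering: "column k (P ** centering_mat) = column k P - mean_column P"
proof -
  have "(\<Sum>l\<in>UNIV. P $ i $ l * (((if l = k then 1 else 0) - 1 / real CARD('b)))) = P $ i $ k - (\<Sum>l\<in>UNIV. P $ i $ l) / real CARD('b)"
    for i by (simp add: right_diff_distrib sum_subtractf sum_divide_distrib if_distrib[of "(*) _"] cong: if_cong)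
  thus ?thesis
    by (simp add: vec_eq_iff column_def matrix_matrix_mult_def centering_mat_def mat_def mean_column_def)
qed

lemma column_mult_label: "column s (A ** label_mat) = column (fst s) A"
  by (simp add: vec_eq_iff column_def matrix_matrix_mult_def label_mat_def if_distrib cong: if_cong)

lemma column_eq_iff: "A = B \<longleftrightarrow> (\<forall>k. column k A = column k B)"
  by (auto simp: vec_eq_iff column_def)

lemma column_scaleR: "column k (r *\<^sub>R A) = r *\<^sub>R column k A"
  by (simp add: vec_eq_iff column_def)

lemma centred_frame_of_orthonormal:
  fixes P :: "real^'k^'d"
  assumes "transpose P ** P = mat 1"
  shows "centred_frame (\<lambda>k. column k P - mean_column P)"
proof -
  note o = assms[unfolded orthonormal_columns_iff, rule_format]
  have 1: "column k P \<bullet> mean_column P = 1 / real CARD('k)" for k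
    by (simp add: mean_column_def inner_sum_right o)
  have 2: "mean_column P \<bullet> mean_column P = 1 / real CARD('k)"
    by (subst (1) mean_column_def) (simp add: inner_sum_left 1)
  show ?thesis
    unfolding centred_frame_def
    by (simp add: inner_diff_left inner_diff_right o 1 2 inner_commute[of "mean_column P" "column _ P"])
qed

lemma orthonormal_of_centred_frame:
  fixes p :: "'k::finite \<Rightarrow> real^'d"
  assumes p: "centred_frame p" and card: "CARD('d) \<ge> CARD('k)"
  obtains P :: "real^'k^'d" where "transpose P ** P = mat 1" "\<And>k. column k P - mean_column P = p k"
proof -
  define K where "K = real CARD('k)"
  have K: "K > 0" by (simp add: K_def)
  obtain k0 :: 'k where True by simp
  \<comment> \<open>The frame sums to zero, so it spans at most K - 1 dimensions and some direction
    of the feature space is orthogonal to it.\<close>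
  have "p k0 = - (\<Sum>k\<in>UNIV - {k0}. p k)"
    using centred_frame_sum[OF p] by (simp add: sum.remove[of UNIV k0] eq_neg_iff_add_eq_0)
  moreover have "(\<Sum>k\<in>UNIV - {k0}. p k) \<in> span (p ` (UNIV - {k0}))"
    by (intro span_sum span_base imageI)
  ultimately have "p k0 \<in> span (p ` (UNIV - {k0}))"
    by (metis span_neg)
  hence "range p \<subseteq> span (p ` (UNIV - {k0}))"
    by (auto intro: span_base)
  hence "dim (range p) \<le> card (p ` (UNIV - {k0}))"
    by (metis dim_le_card finite finite_imageI)
  also have "\<dots> \<le> card (UNIV - {k0})" by (rule card_image_le) simp
  also have "\<dots> < CARD('k)" by (simp add: card_Diff_singleton)
  finally have "dim (range p) < DIM(real^'d)" using card by simp
  then obtain u' where u': "u' \<noteq> 0" "\<And>y. y \<in> span (range p) \<Longrightarrow> orthogonal u' y"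
    using orthogonal_to_subspace_exists[of "range p"] by blast
  define u where "u = (1 / norm u') *\<^sub>R u'"
  have uu: "u \<bullet> u = 1" using u'(1) by (simp add: u_def power2_norm_eq_inner[symmetric] power2_eq_square dot_square_norm)
  have up: "u \<bullet> p k = 0" for k
    using u'(2)[of "p k"] by (simp add: u_def orthogonal_def span_base)
  \<comment> \<open>The common component along \<open>u\<close> adds 1/K to every Gram entry,
    cancelling the -1/K of the frame, and disappears again on subtracting the mean column.\<close>
  define P :: "real^'k^'d" where "P = (\<chi> i k. (p k + (1 / sqrt K) *\<^sub>R u) $ i)"
  have cP: "column k P = p k + (1 / sqrt K) *\<^sub>R u" for k
    by (simp add: vec_eq_iff P_def column_def)
  have "column k P \<bullet> column l P = (if k = l then 1 else 0)" for k l
    using K by (simp add: cP inner_add_left inner_add_right up inner_commute[of "p _" u] uu centred_frame_inner[OF p] K_def)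
  hence "transpose P ** P = mat 1" by (simp add: orthonormal_columns_iff)
  moreover have "column k P - mean_column P = p k" for k
    using K by (simp add: mean_column_def cP sum.distrib centred_frame_sum[OF p] K_def sum_constant_scaleR del: sum_constant)
  ultimately show thesis using that by blast
qed

lemma ex_orthonormal:
  assumes "CARD('d::finite) \<ge> CARD('k::finite)"
  shows "\<exists>P :: real^'k^'d. transpose P ** P = mat 1"
proof -
  obtain f :: "'k \<Rightarrow> 'd" where f: "inj f"
    using assms card_le_inj[of "UNIV :: 'k set" "UNIV :: 'd set"] by auto
  define P :: "real^'k^'d" where "P = (\<chi> i k. axis (f k) 1 $ i)"
  have "column k P = axis (f k) 1" for k by (simp add: vec_eq_iff P_def column_def)
  hence "transpose P ** P = mat 1"
    using f by (auto simp: orthonormal_columns_iff inner_axis_axis inj_eq)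
  thus ?thesis by blast
qed

lemma collapsed_point_iff_frame:
  fixes W :: "real^'k^'d" and H :: "real^('k::finite \<times> 'n::finite)^'d" and lW lH \<delta> :: real
  assumes card: "CARD('d) \<ge> CARD('k)"
  defines "a \<equiv> a_param CARD('k) CARD('k \<times> 'n) lW lH \<delta>"
  shows "(\<exists>P :: real^'k^'d. transpose P ** P = mat 1 \<and> collapsed_point lW lH \<delta> P W H b) \<longleftrightarrow>
    (\<exists>p. centred_frame p \<and> (\<forall>k. column k W = ((real CARD('n) * lH / lW) powr (1/4) * sqrt a) *\<^sub>R p k)
       \<and> (\<forall>s. column s H = ((lW / (real CARD('n) * lH)) powr (1/4) * sqrt a) *\<^sub>R p (fst s)) \<and> b = 0)"
proof -
  have cp: "collapsed_point lW lH \<delta> P W H b \<longleftrightarrow>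
      (\<forall>k. column k W = ((real CARD('n) * lH / lW) powr (1/4) * sqrt a) *\<^sub>R (column k P - mean_column P))
       \<and> (\<forall>s. column s H = ((lW / (real CARD('n) * lH)) powr (1/4) * sqrt a) *\<^sub>R (column (fst s) P - mean_column P)) \<and> b = 0"
    for P :: "real^'k^'d"
    by (simp add: collapsed_point_def Let_def a_def column_eq_iff[of W] column_eq_iff[of H] column_scaleR
        column_mult_label column_centering)
  show ?thesis
    unfolding cp using centred_frame_of_orthonormal orthonormal_of_centred_frame[OF _ card]
    by (smt (verit, ccfv_threshold))
qed

text \<open>The logarithm in \<open>a_param\<close> is arranged so that the softmax denominator K -
  1 + exp a equals K / (c + \<delta>). All probabilities thus become affine in \<delta>.\<close>

lemma collapse_parameters:
  fixes K N :: nat and lW lH \<delta> :: real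
  defines "c \<equiv> sqrt (real K * real N * lW * lH)"
  assumes pos: "K \<ge> 2" "N > 0" "lW > 0" "lH > 0" and \<delta>: "0 \<le> \<delta>" "c + \<delta> < 1"
  shows "a_param K N lW lH \<delta> > 0"
    and "collapsed_prob K (a_param K N lW lH \<delta>) = (c + \<delta>) / real K"
    and "p_target K N lW lH \<delta> = 1 - (real K - 1) * ((c + \<delta>) / real K)"
proof -
  have K: "real K > 0" using pos by simp
  have c: "c + \<delta> > 0" using pos \<delta> by (simp add: c_def add_pos_nonneg)
  have "real K / (c + \<delta>) > real K"
    using K c \<delta>(2) by (simp add: pos_less_divide_eq)
  hence gt: "real K / (c + \<delta>) - real K + 1 > 1" by simp
  have a: "a_param K N lW lH \<delta> = ln (real K / (c + \<delta>) - real K + 1)"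
    by (simp add: a_param_def c_def)
  show "a_param K N lW lH \<delta> > 0" unfolding a using gt by (rule ln_gt_zero)
  have e: "exp (a_param K N lW lH \<delta>) = real K / (c + \<delta>) - real K + 1"
    unfolding a using gt by (intro exp_ln) linarith
  show "collapsed_prob K (a_param K N lW lH \<delta>) = (c + \<delta>) / real K"
    by (simp add: collapsed_prob_def e)
  have den: "real K - 1 + (real K / (c + \<delta>) - real K + 1) = real K / (c + \<delta>)"
    by simp
  have frac: "(real K / t - real K + 1) / (real K / t) = 1 - (real K - 1) * (t / real K)" if "t > 0" for t
    using K that by (simp add: field_simps)
  show "p_target K N lW lH \<delta> = 1 - (real K - 1) * ((c + \<delta>) / real K)"
    unfolding p_target_def e den using frac[OF c] .
qed

text \<open>For x = n lH / lW these relate the scalings in \<open>collapsed_point\<close> to the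
  proportionality factor \<open>\<mu>\<close> = sqrt (1 / x): it carries the scale of
  \<open>W\<close> to that of \<open>H\<close>, and the product of the two scales is
  \<open>a\<close>.\<close>

lemma quarter_powers:
  fixes x a :: real
  assumes "x > 0" "a > 0"
  shows "sqrt (1 / x) * (x powr (1/4) * sqrt a) = (1 / x) powr (1/4) * sqrt a"
    and "sqrt (1 / x) * (x powr (1/4) * sqrt a)\<^sup>2 = a"
proof -
  have "(x powr (1/4))\<^sup>2 = sqrt x"
    using assms by (simp add: power2_eq_square powr_half_sqrt flip: powr_add)
  moreover have "(1 / x) powr (1/4) = 1 / x powr (1/4)"
    using assms by (simp add: powr_divide)
  moreover have "x powr (1/4) > 0" "sqrt x > 0" using assms by simp_all
  ultimately show "sqrt (1 / x) * (x powr (1/4) * sqrt a) = (1 / x) powr (1/4) * sqrt a"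
    "sqrt (1 / x) * (x powr (1/4) * sqrt a)\<^sup>2 = a"
    using assms by (simp_all add: real_sqrt_divide power_mult_distrib) (simp_all add: field_simps power2_eq_square)
qed

lemma global_minimizer_iff_collapsed:
  fixes W :: "real^'k^'d" and H :: "real^('k::finite \<times> 'n::finite)^'d" and b :: "real^'k"
    and lW lH lb \<delta> :: real
  assumes card: "CARD('k) \<ge> 2" "CARD('d) \<ge> CARD('k)"
    and pos: "lW > 0" "lH > 0" "lb > 0" and \<delta>: "0 \<le> \<delta>"
    and small: "sqrt (real CARD('k) * real CARD('k \<times> 'n) * lW * lH) + \<delta> < 1"
  shows "global_minimizer lW lH lb \<delta> W H b \<longleftrightarrow>
    (\<exists>P :: real^'k^'d. transpose P ** P = mat 1 \<and> collapsed_point lW lH \<delta> P W H b)"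
proof -
  define K n N where "K = real CARD('k)" and "n = real CARD('n)" and "N = real CARD('k \<times> 'n)"
  have Kn: "K > 0" "n > 0" "N = K * n" by (simp_all add: K_def n_def N_def)
  define c where "c = sqrt (K * N * lW * lH)"
  define a where "a = a_param CARD('k) CARD('k \<times> 'n) lW lH \<delta>"
  have par: "a > 0" "collapsed_prob CARD('k) a = (c + \<delta>) / K"
    using collapse_parameters[OF card(1) _ pos(1,2) \<delta> small] by (simp_all add: a_def c_def K_def N_def)
  define \<mu> where "\<mu> = sqrt (1 / (n * lH / lW))"
  define \<sigma> where "\<sigma> = (n * lH / lW) powr (1/4) * sqrt a"
  have x: "n * lH / lW > 0" using Kn pos by simp
  have inv: "lW / (n * lH) = 1 / (n * lH / lW)" by simp
  have \<mu>: "\<mu> > 0" using Kn pos unfolding \<mu>_def by simp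
  have \<sigma>: "\<sigma> > 0" using Kn pos par(1) by (simp add: \<sigma>_def)
  have \<mu>\<sigma>: "\<mu> * \<sigma> = (lW / (n * lH)) powr (1/4) * sqrt a" "\<mu> * \<sigma>\<^sup>2 = a"
    unfolding \<mu>_def \<sigma>_def inv by (rule quarter_powers[OF x par(1)])+
  have \<mu>2: "\<mu>\<^sup>2 = lW / (n * lH)" unfolding \<mu>_def inv using Kn pos by (intro real_sqrt_pow2) simp
  have \<mu>1: "lH * n * \<mu>\<^sup>2 = lW" unfolding \<mu>2 using Kn pos by simp
  have c: "N * lH * \<mu> = c"
    unfolding c_def
  proof (rule real_sqrt_unique[symmetric])
    have "(N * lH * \<mu>)\<^sup>2 = K * N * (lH * n * \<mu>\<^sup>2) * lH" by (simp add: Kn(3) power2_eq_square)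
    thus "(N * lH * \<mu>)\<^sup>2 = K * N * lW * lH" by (simp only: \<mu>1)
    show "0 \<le> N * lH * \<mu>" using Kn pos \<mu> by simp
  qed
  \<comment> \<open>Smoothing cancels: off the target the softmax (c + \<delta>) / K exceeds the
    label \<delta> / K by c / K, and the target entry balances the sum to zero. The coefficient c is
    N lH \<open>\<mu>\<close> by the previous step.\<close>
  have grad: "softmax (collapsed_logits a (fst s)) $ j - column s (smoothed_label_mat \<delta> :: real^('k \<times> 'n)^'k) $ j
      = - (N * lH * \<mu>) * ((if j = fst s then 1 else 0) - 1 / K)" for s j
  proof -
    have 1: "softmax (collapsed_logits a (fst s)) $ j = collapsed_prob CARD('k) a
      + (if j = fst s then 1 - K * collapsed_prob CARD('k) a else 0)"
      unfolding collapsed_prob_def K_def by (rule softmax_collapsed) (simp add: collapsed_logits_def)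
    have 2: "column s (smoothed_label_mat \<delta> :: real^('k \<times> 'n)^'k) $ j
      = (1 - \<delta>) * (if j = fst s then 1 else 0) + \<delta> / K"
      by (simp add: column_def smoothed_label_mat_def label_mat_def K_def)
    show ?thesis unfolding 1 2 c par(2) using Kn(1) by (cases "j = fst s") (simp_all add: field_simps)
  qed
  define C where "C = (\<Sum>s\<in>UNIV. ce_loss (collapsed_logits a (fst s)) (column s (smoothed_label_mat \<delta> :: real^('k \<times> 'n)^'k))
        - (softmax (collapsed_logits a (fst s)) - column s (smoothed_label_mat \<delta> :: real^('k \<times> 'n)^'k))
          \<bullet> collapsed_logits a (fst s)) / real CARD('k \<times> 'n)"
  have loss: "regularized_loss lW lH lb \<delta> W H b = C + excess_loss lW lH lb \<mu> a W H b"
    for W :: "real^'k^'d" and H :: "real^('k \<times> 'n)^'d" and b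
    unfolding C_def
    by (rule regularized_loss_eq_excess[OF pos(2) \<mu>1[unfolded n_def] grad[unfolded N_def K_def]])
  have zero_iff: "excess_loss lW lH lb \<mu> a W H b = 0 \<longleftrightarrow>
      (\<exists>P :: real^'k^'d. transpose P ** P = mat 1 \<and> collapsed_point lW lH \<delta> P W H b)"
    for W :: "real^'k^'d" and H :: "real^('k \<times> 'n)^'d" and b
    unfolding excess_loss_eq_0_iff_frame[OF pos \<mu> \<sigma> \<mu>\<sigma>(2)] \<mu>\<sigma>(1) collapsed_point_iff_frame[OF card(2)]
    by (simp only: \<sigma>_def a_def n_def)
  \<comment> \<open>The excess is nonnegative, so once the value 0 is attained somewhere, the global
    minimizers are exactly its zeros.\<close>
  obtain P :: "real^'k^'d" where P: "transpose P ** P = mat 1" using ex_orthonormal[OF card(2)] by blast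
  obtain W0 :: "real^'k^'d" and H0 :: "real^('k \<times> 'n)^'d" where "collapsed_point lW lH \<delta> P W0 H0 0"
    by (simp add: collapsed_point_def Let_def)
  hence W0: "excess_loss lW lH lb \<mu> a W0 H0 0 = 0" using zero_iff P by blast
  have "global_minimizer lW lH lb \<delta> W H b \<longleftrightarrow> excess_loss lW lH lb \<mu> a W H b = 0"
    unfolding global_minimizer_def loss using W0 excess_loss_nonneg[OF pos]
    by (metis add_le_cancel_left order_antisym)
  thus ?thesis unfolding zero_iff .
qed

lemma condition_number_collapsed:
  fixes W :: "real^'k^'d" and H :: "real^('k::finite \<times> 'n::finite)^'d" and b :: "real^'k"
    and lW lH \<delta> :: real
  assumes card: "CARD('k) \<ge> 2" "CARD('d) \<ge> CARD('k)"
    and pos: "lW > 0" "lH > 0" and \<delta>: "0 \<le> \<delta>"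
    and small: "sqrt (real CARD('k) * real CARD('k \<times> 'n) * lW * lH) + \<delta> < 1"
    and P: "transpose P ** P = mat 1" "collapsed_point lW lH \<delta> P W H b"
  defines "\<kappa> \<equiv> (if CARD('k) \<ge> 3 then real CARD('k) * p_target CARD('k) CARD('k \<times> 'n) lW lH \<delta> else 1)"
  shows "condition_number (hessian_W \<delta> W H) = \<kappa>" "condition_number (hessian_H \<delta> W H) = \<kappa>"
proof -
  define n where "n = real CARD('n)"
  define a where "a = a_param CARD('k) CARD('k \<times> 'n) lW lH \<delta>"
  have par: "a > 0" "collapsed_prob CARD('k) a
      = (sqrt (real CARD('k) * real CARD('k \<times> 'n) * lW * lH) + \<delta>) / real CARD('k)"
    and pt: "p_target CARD('k) CARD('k \<times> 'n) lW lH \<delta> = 1 - (real CARD('k) - 1) * collapsed_prob CARD('k) a"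
    using collapse_parameters[OF card(1) _ pos \<delta> small] by (simp_all add: a_def)
  have x: "n * lH / lW > 0" using pos by (simp add: n_def)
  have inv: "lW / (n * lH) = 1 / (n * lH / lW)" by simp
  obtain p where p: "centred_frame p"
    "\<And>k. column k W = ((n * lH / lW) powr (1/4) * sqrt a) *\<^sub>R p k"
    "\<And>s. column s H = ((lW / (n * lH)) powr (1/4) * sqrt a) *\<^sub>R p (fst s)"
    using collapsed_point_iff_frame[OF card(2), where W = W and H = H and lW = lW and lH = lH and \<delta> = \<delta> and b = b] P
    unfolding a_def n_def by blast
  have \<sigma>\<tau>: "((n * lH / lW) powr (1/4) * sqrt a) * ((lW / (n * lH)) powr (1/4) * sqrt a) = a"
    using quarter_powers[OF x par(1)] unfolding inv power2_eq_square by (metis mult.left_commute)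
  \<comment> \<open>With q the wrong-class probability, 1 + (K - 1)(1 - K q) = K (1 - (K - 1) q),
    which is K times the target probability.\<close>
  have \<kappa>: "\<kappa> = (if CARD('k) \<ge> 3
    then 1 + (real CARD('k) - 1) * (1 - real CARD('k) * collapsed_prob CARD('k) a) else 1)"
    unfolding \<kappa>_def pt by (simp add: algebra_simps)
  show "condition_number (hessian_W \<delta> W H) = \<kappa>" "condition_number (hessian_H \<delta> W H) = \<kappa>"
    unfolding \<kappa> using condition_number_hessian_W[OF card(1) p \<sigma>\<tau> par(1)]
      condition_number_hessian_H[OF card(1) p \<sigma>\<tau> par(1)] by blast+
qed

lemma p_target_strict_antimono:
  fixes K N :: nat and lW lH \<delta> \<delta>' :: real
  assumes "K \<ge> 2" "N > 0" "lW > 0" "lH > 0" "0 \<le> \<delta>" "\<delta> < \<delta>'"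
    and "sqrt (real K * real N * lW * lH) + \<delta>' < 1"
  shows "p_target K N lW lH \<delta>' < p_target K N lW lH \<delta>"
proof -
  let ?c = "sqrt (real K * real N * lW * lH)"
  have "p_target K N lW lH \<delta> = 1 - (real K - 1) * ((?c + \<delta>) / real K)"
    "p_target K N lW lH \<delta>' = 1 - (real K - 1) * ((?c + \<delta>') / real K)"
    using assms by (intro collapse_parameters(3); simp)+
  moreover have "(?c + \<delta>) / real K < (?c + \<delta>') / real K" using assms by (simp add: divide_strict_right_mono)
  hence "(real K - 1) * ((?c + \<delta>) / real K) < (real K - 1) * ((?c + \<delta>') / real K)"
    using assms(1) by (intro mult_strict_left_mono) auto
  ultimately show ?thesis by simp
qed

text \<open>The explicit form of the minimizers is proved as an equivalence. The case K = 2 is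
  separate because all nonzero eigenvalues then coincide and the ratio is 1, whereas K p_t exceeds 1
  since p_t > 1/2; the comparison of condition numbers is accordingly stated for K at least
  3.\<close>

theorem theorem4p2:
  fixes lW lH lb \<delta> :: real
    and W :: "real^'k^'d" and H :: "real^('k::finite \<times> 'n::finite)^'d" and b :: "real^'k"
  assumes "CARD('k) \<ge> 2" and "CARD('d) \<ge> CARD('k)"
    and "lW > 0" and "lH > 0" and "lb > 0"
    and "0 \<le> \<delta>" and "\<delta> < 1"
    and "sqrt (real CARD('k) * real CARD('k \<times> 'n) * lW * lH) + \<delta> < 1"
  shows
    "(global_minimizer lW lH lb \<delta> W H b \<longleftrightarrow>
        (\<exists>P :: real^'k^'d. transpose P ** P = mat 1 \<and> collapsed_point lW lH \<delta> P W H b))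
     \<and> (global_minimizer lW lH lb \<delta> W H b \<longrightarrow>
         (CARD('k) \<ge> 3 \<longrightarrow>
            condition_number (hessian_W \<delta> W H)
              = real CARD('k) * p_target CARD('k) CARD('k \<times> 'n) lW lH \<delta> \<and>
            condition_number (hessian_H \<delta> W H)
              = real CARD('k) * p_target CARD('k) CARD('k \<times> 'n) lW lH \<delta>) \<and>
         (CARD('k) = 2 \<longrightarrow>
            condition_number (hessian_W \<delta> W H) = 1 \<and>
            condition_number (hessian_H \<delta> W H) = 1))
     \<and> (\<forall>\<delta>'. \<delta> < \<delta>' \<and> \<delta>' < 1 \<and> sqrt (real CARD('k) * real CARD('k \<times> 'n) * lW * lH) + \<delta>' < 1 \<longrightarrow>
          p_target CARD('k) CARD('k \<times> 'n) lW lH \<delta>' < p_target CARD('k) CARD('k \<times> 'n) lW lH \<delta> \<and>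
          (CARD('k) \<ge> 3 \<and> global_minimizer lW lH lb \<delta> W H b \<longrightarrow>
            (\<forall>(W' :: real^'k^'d) (H' :: real^('k \<times> 'n)^'d) (b' :: real^'k).
              global_minimizer lW lH lb \<delta>' W' H' b' \<longrightarrow>
                condition_number (hessian_W \<delta>' W' H') < condition_number (hessian_W \<delta> W H) \<and>
                condition_number (hessian_H \<delta>' W' H') < condition_number (hessian_H \<delta> W H))))"
proof (intro conjI allI impI; (elim conjE)?)
  note iff = global_minimizer_iff_collapsed[OF assms(1-6) assms(8)]
  show "global_minimizer lW lH lb \<delta> W H b \<longleftrightarrow>
      (\<exists>P :: real^'k^'d. transpose P ** P = mat 1 \<and> collapsed_point lW lH \<delta> P W H b)"
    by (rule iff)
  let ?\<kappa> = "\<lambda>\<delta>. if CARD('k) \<ge> 3 then real CARD('k) * p_target CARD('k) CARD('k \<times> 'n) lW lH \<delta> else 1"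
  \<comment> \<open>The condition numbers depend on the minimizer only through the smoothing
    parameter, so comparing arbitrary minimizers for two parameters reduces to comparing
    \<open>p_target\<close>.\<close>
  have cond: "condition_number (hessian_W \<epsilon> W' H') = ?\<kappa> \<epsilon> \<and> condition_number (hessian_H \<epsilon> W' H') = ?\<kappa> \<epsilon>"
    if "global_minimizer lW lH lb \<epsilon> W' H' b'" "0 \<le> \<epsilon>"
      "sqrt (real CARD('k) * real CARD('k \<times> 'n) * lW * lH) + \<epsilon> < 1"
    for \<epsilon> and W' :: "real^'k^'d" and H' :: "real^('k \<times> 'n)^'d" and b'
    using condition_number_collapsed[OF assms(1-4) that(2,3)] that(1)
      global_minimizer_iff_collapsed[OF assms(1-5) that(2,3)] by blast
  show "condition_number (hessian_W \<delta> W H) = real CARD('k) * p_target CARD('k) CARD('k \<times> 'n) lW lH \<delta>"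
    "condition_number (hessian_H \<delta> W H) = real CARD('k) * p_target CARD('k) CARD('k \<times> 'n) lW lH \<delta>"
    if "global_minimizer lW lH lb \<delta> W H b" "CARD('k) \<ge> 3"
    using cond[OF that(1) assms(6,8)] that(2) by simp_all
  show "condition_number (hessian_W \<delta> W H) = 1" "condition_number (hessian_H \<delta> W H) = 1"
    if "global_minimizer lW lH lb \<delta> W H b" "CARD('k) = 2"
    using cond[OF that(1) assms(6,8)] that(2) by simp_all
  fix \<delta>'
  assume \<delta>': "\<delta> < \<delta>'" "sqrt (real CARD('k) * real CARD('k \<times> 'n) * lW * lH) + \<delta>' < 1"
  have \<delta>'0: "0 \<le> \<delta>'" using assms(6) \<delta>'(1) by simp
  show less: "p_target CARD('k) CARD('k \<times> 'n) lW lH \<delta>' < p_target CARD('k) CARD('k \<times> 'n) lW lH \<delta>"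
    using assms \<delta>' by (intro p_target_strict_antimono) auto
  fix W' :: "real^'k^'d" and H' :: "real^('k \<times> 'n)^'d" and b' :: "real^'k"
  assume min: "CARD('k) \<ge> 3" "global_minimizer lW lH lb \<delta> W H b" "global_minimizer lW lH lb \<delta>' W' H' b'"
  show "condition_number (hessian_W \<delta>' W' H') < condition_number (hessian_W \<delta> W H)"
    "condition_number (hessian_H \<delta>' W' H') < condition_number (hessian_H \<delta> W H)"
    using cond[OF min(2) assms(6,8)] cond[OF min(3) \<delta>'0 \<delta>'(2)] min(1) less by simp_all
qed

end
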